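(* Let $N,d\ge 1$, let $\varepsilon\in(0,1/16)$, and assume that either the synchronous or the asynchronous oracle is used. Let $r,B,\sigma>0$ and let $b=(b_{ij})_{1\le i,j\le N}$ be non-negative reals satisfying $b_{ij}\le b_{ik}+b_{kj}$ for all $1\le i,j,k\le N$. There exist constants $C,C'>0$, independent of the problem, such that for every $i\in\{1,\dots,N\}$: $$\inf_{\mathcal M\in\mathbb M}\ \sup_{((\mathcal D_j)_j,\ell)\in\mathbb D(r,b,B)}\ \mathcal T_i^{\varepsilon}\Big(\mathcal M,\big((\mathcal D_j)_j,\ell\big)\Big)\ \ge\ \frac{C\,r^2B^2N}{\varepsilon^{2}\,\mathcal N_i^\varepsilon(b/4)},$$ and, under strong convexity and smoothness assumptions with $\mu=L=1/r^2$, $$\inf_{\mathcal M\in\mathbb M}\ \sup_{((\mathcal D_j)_j,\ell)\in\mathbb D_{\mu=1/r^2}^{L=1/r^2}(r,b,\sigma)}\ \mathcal T_i^{\varepsilon}\Big(\mathcal M,\big((\mathcal D_j)_j,\ell\big)\Big)\ \ge\ \frac{C'\,r^2\sigma^2N}{\varepsilon\,\mathcal N_i^\varepsilon(b/4)}.$$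
   Context: Problem (collaborative generalization error minimization). There are $N$ agents. A loss $\ell:\mathbb R^d\times\Xi\to\mathbb R$ is shared by all agents and agent $i$ has a probability distribution $\mathcal D_i$ on $\Xi\subset\mathbb R^D$; its objective is $f_i(x)=\mathbb E_{\xi_i\sim\mathcal D_i}[\ell(x,\xi_i)]$. Each $f_i$ is assumed to have a minimizer $x_i^\star$ over $\mathbb R^d$. Stochastic (sub)gradients are $g_i^k(x)=\nabla_x\ell(x,\xi_i^k)$ (or a subgradient in $x$), with $\xi_i^k\sim\mathcal D_i$ i.i.d. in $k$, so that $\mathbb E[g_i^k(x)]\in\partial f_i(x)$. Oracles. At each iteration $k=1,2,\dots$ a set $S^k$ of agents is chosen: $S^k=\{1,\dots,N\}$ for the synchronous oracle; $S^k=\{i_k\}$ with $i_k$ uniform on $\{1,\dots,N\}$ for the asynchronous oracle. For a query $x\in\mathbb R^{N\times d}$ (chosen as a possibly random function of all previously revealed information) the oracle returns $\big(i,x_i,\xi_i,\ell(x_i,\xi_i),g_i^k(x_i)\big)_{i\in S^k}$ with $\xi_i\sim\mathcal D_i$ (and $g_i^k$ computed from this sample). $K$ oracle calls use $T=NK$ samples in total (synchronous) or $T=K$ samples (asynchronous). $\mathbb M$ is the set of all methods $\mathcal M=(\mathcal M_T)_{T\ge0}$, where $\mathcal M_T$ interacts with the oracle using $T$ stochastic gradient samples in total from all agents and returns $x_i^T\in\mathbb R^d$ for agent $i$. The sample complexity is $$\mathcal T_i^\varepsilon\Big(\mathcal M,\big((\mathcal D_j)_j,\ell\big)\Big)=\inf\Big\{T\in\mathbb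 N^*:\ \mathbb E\big[f_i(x_i^T)-\min_{x\in\mathbb R^d}f_i(x)\big]\le\varepsilon\Big\}.$$ For $c>0$, $\mathcal N_i^\varepsilon(cb)=\sum_{j=1}^N\mathbf 1_{\{c\,b_{ij}\le\varepsilon\}}$. $\mathbb D(r,b,B)$ is the set of all $((\mathcal D_i)_{1\le i\le N},\ell)$ such that, for all $1\le i,j\le N$, all $x\in\mathbb R^d$ and all $k$: $\|x_i^\star\|\le r$; $f_i$ is convex and $\mathbb E\|g_i^k(x)\|^2\le B^2$; $f_i(x_j^\star)-f_i(x_i^\star)\le b_{ij}$; and $\|\mathbb E[g_i^k(x)]-\mathbb E[g_j^k(x)]\|^2\le (b_{ij}/r)^2$. $\mathbb D_\mu^L(r,b,\sigma)$ is the set of all $((\mathcal D_i)_{1\le i\le N},\ell)$ such that, for all $1\le i,j\le N$, all $x\in\mathbb R^d$ and all $k$: $\|x_i^\star\|\le r$; $f_i$ is $\mu$-strongly convex and $L$-smooth with $\mathbb E\|g_i^k(x)-\nabla f_i(x)\|^2\le\sigma^2$; $f_i(x_j^\star)-f_i(x_i^\star)\le b_{ij}$; and $\|\nabla f_i(x)-\nabla f_j(x)\|^2\le\mu b_{ij}$.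
   Formalization: The sample complexity is taken as the least budget from which on the error stays at most ε; b is assumed symmetric; the first bound for the asynchronous oracle assumes ε < rB/16; where N_i^ε(b/4)=0 the right-hand side is read as 0. *)

theory Defs
  imports "HOL-Probability.Probability"
begin

section \<open>Euclidean spaces of variable dimension\<close>

text \<open>The constants of the lower bounds must not depend on the dimensions, so the dimension has
  to be quantified inside the statement and cannot be a type. The space of real vectors of
  dimension \<open>n\<close> is therefore the set of extensional functions on \<open>{..<n}\<close>, with the
  product (= Borel) sigma-algebra and the norm \<^const>\<open>L2_set\<close>.\<close>

type_synonym rvec = "nat \<Rightarrow> real"

definition Rn :: "nat \<Rightarrow> rvec set" where
  "Rn n = {..<n} \<rightarrow>\<^sub>E UNIV"

definition Rn_borel :: "nat \<Rightarrow> rvec measure" where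
  "Rn_borel n = (\<Pi>\<^sub>M c\<in>{..<n}. borel)"

definition zero_vec :: "nat \<Rightarrow> rvec" where
  "zero_vec n = (\<lambda>c\<in>{..<n}. 0)"

definition norm_Rn :: "nat \<Rightarrow> rvec \<Rightarrow> real" where
  "norm_Rn n x = L2_set x {..<n}"

definition dist_Rn :: "nat \<Rightarrow> rvec \<Rightarrow> rvec \<Rightarrow> real" where
  "dist_Rn n x y = L2_set (\<lambda>c. x c - y c) {..<n}"

definition has_gradient :: "nat \<Rightarrow> (rvec \<Rightarrow> real) \<Rightarrow> rvec \<Rightarrow> rvec \<Rightarrow> bool" where
  "has_gradient n f x v \<longleftrightarrow>
     (\<forall>e>0. \<exists>\<delta>>0. \<forall>y\<in>Rn n. dist_Rn n y x < \<delta> \<longrightarrow>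
        \<bar>f y - f x - (\<Sum>c<n. v c * (y c - x c))\<bar> \<le> e * dist_Rn n y x)"

definition has_subgradient :: "nat \<Rightarrow> (rvec \<Rightarrow> real) \<Rightarrow> rvec \<Rightarrow> rvec \<Rightarrow> bool" where
  "has_subgradient n f x v \<longleftrightarrow> (\<forall>y\<in>Rn n. f x + (\<Sum>c<n. v c * (y c - x c)) \<le> f y)"

definition convex_Rn :: "nat \<Rightarrow> (rvec \<Rightarrow> real) \<Rightarrow> bool" where
  "convex_Rn n f \<longleftrightarrow>
     (\<forall>x\<in>Rn n. \<forall>y\<in>Rn n. \<forall>t\<in>{0..1}.
        f (\<lambda>c\<in>{..<n}. (1 - t) * x c + t * y c) \<le> (1 - t) * f x + t * f y)"

definition strongly_convex_Rn :: "nat \<Rightarrow> real \<Rightarrow> (rvec \<Rightarrow> real) \<Rightarrow> bool" where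
  "strongly_convex_Rn n mu f \<longleftrightarrow>
     (\<forall>x\<in>Rn n. \<forall>y\<in>Rn n. \<forall>t\<in>{0..1}.
        f (\<lambda>c\<in>{..<n}. (1 - t) * x c + t * y c)
          \<le> (1 - t) * f x + t * f y - mu / 2 * t * (1 - t) * (dist_Rn n x y)\<^sup>2)"

text \<open>\<open>L\<close>-smoothness; \<open>G\<close> is the gradient field of \<open>f\<close>.\<close>

definition smooth_Rn :: "nat \<Rightarrow> real \<Rightarrow> (rvec \<Rightarrow> real) \<Rightarrow> (rvec \<Rightarrow> rvec) \<Rightarrow> bool" where
  "smooth_Rn n L f G \<longleftrightarrow>
     (\<forall>x\<in>Rn n. G x \<in> Rn n \<and> has_gradient n f x (G x)) \<and>
     (\<forall>x\<in>Rn n. \<forall>y\<in>Rn n. dist_Rn n (G x) (G y) \<le> L * dist_Rn n x y)"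


section \<open>Collaborative learning problems\<close>

text \<open>Agents are numbered \<open>1, \<dots>, N\<close>. A problem consists of the sample set, the sample
  distribution of each agent, the common loss \<open>loss x \<xi>\<close>, and the selection
  \<open>sgrad x \<xi>\<close> of a (sub)gradient of the loss in \<open>x\<close>, so that the stochastic gradient of
  agent \<open>i\<close> at \<open>x\<close> is \<open>sgrad x \<xi>\<close> with \<open>\<xi>\<close> drawn from
  \<open>sample_dist i\<close>.\<close>

record problem =
  sample_set :: "rvec set"
  sample_dist :: "nat \<Rightarrow> rvec measure"
  loss :: "rvec \<Rightarrow> rvec \<Rightarrow> real"
  sgrad :: "rvec \<Rightarrow> rvec \<Rightarrow> rvec"

definition objective :: "problem \<Rightarrow> nat \<Rightarrow> rvec \<Rightarrow> real" where
  "objective P i x = (\<integral>\<xi>. loss P x \<xi> \<partial>sample_dist P i)"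

definition mean_grad :: "nat \<Rightarrow> problem \<Rightarrow> nat \<Rightarrow> rvec \<Rightarrow> rvec" where
  "mean_grad d P i x = (\<lambda>c\<in>{..<d}. \<integral>\<xi>. sgrad P x \<xi> c \<partial>sample_dist P i)"

text \<open>Standing assumptions; measurability and integrability make all expectations meaningful,
  also at random query points.\<close>

definition well_posed :: "nat \<Rightarrow> nat \<Rightarrow> nat \<Rightarrow> problem \<Rightarrow> bool" where
  "well_posed N d D P \<longleftrightarrow>
     sample_set P \<subseteq> Rn D \<and>
     (\<forall>i\<in>{1..N}. prob_space (sample_dist P i) \<and>
        sets (sample_dist P i) = sets (restrict_space (Rn_borel D) (sample_set P))) \<and>
     (\<lambda>(x, \<xi>). loss P x \<xi>)
        \<in> borel_measurable (Rn_borel d \<Otimes>\<^sub>M restrict_space (Rn_borel D) (sample_set P)) \<and>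
     (\<lambda>(x, \<xi>). sgrad P x \<xi>)
        \<in> Rn_borel d \<Otimes>\<^sub>M restrict_space (Rn_borel D) (sample_set P) \<rightarrow>\<^sub>M Rn_borel d \<and>
     (\<forall>x\<in>Rn d. \<forall>\<xi>\<in>sample_set P.
        has_gradient d (\<lambda>y. loss P y \<xi>) x (sgrad P x \<xi>) \<or>
        has_subgradient d (\<lambda>y. loss P y \<xi>) x (sgrad P x \<xi>)) \<and>
     (\<forall>i\<in>{1..N}. \<forall>x\<in>Rn d.
        integrable (sample_dist P i) (loss P x) \<and>
        (\<forall>c<d. integrable (sample_dist P i) (\<lambda>\<xi>. sgrad P x \<xi> c)) \<and>
        has_subgradient d (objective P i) x (mean_grad d P i x))"

text \<open>\<open>xs i\<close> is a minimizer of the objective of agent \<open>i\<close>.\<close>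

definition minimizers :: "nat \<Rightarrow> nat \<Rightarrow> problem \<Rightarrow> (nat \<Rightarrow> rvec) \<Rightarrow> bool" where
  "minimizers N d P xs \<longleftrightarrow>
     (\<forall>i\<in>{1..N}. xs i \<in> Rn d \<and> (\<forall>y\<in>Rn d. objective P i (xs i) \<le> objective P i y))"

definition convex_problems ::
  "nat \<Rightarrow> nat \<Rightarrow> nat \<Rightarrow> real \<Rightarrow> (nat \<Rightarrow> nat \<Rightarrow> real) \<Rightarrow> real \<Rightarrow> problem set" where
  "convex_problems N d D r b B = {P. well_posed N d D P \<and>
     (\<exists>xs. minimizers N d P xs \<and>
       (\<forall>i\<in>{1..N}. norm_Rn d (xs i) \<le> r \<and>
          convex_Rn d (objective P i) \<and>
          (\<forall>x\<in>Rn d.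
             (\<integral>\<^sup>+\<xi>. ennreal ((norm_Rn d (sgrad P x \<xi>))\<^sup>2) \<partial>sample_dist P i) \<le> ennreal (B\<^sup>2))) \<and>
       (\<forall>i\<in>{1..N}. \<forall>j\<in>{1..N}.
          objective P i (xs j) - objective P i (xs i) \<le> b i j \<and>
          (\<forall>x\<in>Rn d. (dist_Rn d (mean_grad d P i x) (mean_grad d P j x))\<^sup>2 \<le> (b i j / r)\<^sup>2)))}"

definition strongly_convex_problems ::
  "nat \<Rightarrow> nat \<Rightarrow> nat \<Rightarrow> real \<Rightarrow> real \<Rightarrow> real \<Rightarrow> (nat \<Rightarrow> nat \<Rightarrow> real) \<Rightarrow> real \<Rightarrow> problem set" where
  "strongly_convex_problems N d D mu L r b s = {P. well_posed N d D P \<and>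
     (\<exists>xs G. minimizers N d P xs \<and>
       (\<forall>i\<in>{1..N}. norm_Rn d (xs i) \<le> r \<and>
          strongly_convex_Rn d mu (objective P i) \<and>
          smooth_Rn d L (objective P i) (G i) \<and>
          (\<forall>x\<in>Rn d.
             (\<integral>\<^sup>+\<xi>. ennreal ((dist_Rn d (sgrad P x \<xi>) (G i x))\<^sup>2) \<partial>sample_dist P i)
               \<le> ennreal (s\<^sup>2))) \<and>
       (\<forall>i\<in>{1..N}. \<forall>j\<in>{1..N}.
          objective P i (xs j) - objective P i (xs i) \<le> b i j \<and>
          (\<forall>x\<in>Rn d. (dist_Rn d (G i x) (G j x))\<^sup>2 \<le> mu * b i j)))}"


section \<open>Oracles and learning methods\<close>

datatype oracle_kind = Synchronous | Asynchronous

definition agent_choice :: "oracle_kind \<Rightarrow> nat \<Rightarrow> nat set pmf" where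
  "agent_choice orc N = (case orc of
      Synchronous \<Rightarrow> return_pmf {1..N}
    | Asynchronous \<Rightarrow> map_pmf (\<lambda>i. {i}) (pmf_of_set {1..N}))"

definition samples_used :: "oracle_kind \<Rightarrow> nat \<Rightarrow> nat \<Rightarrow> nat" where
  "samples_used orc N K = (case orc of Synchronous \<Rightarrow> N * K | Asynchronous \<Rightarrow> K)"

text \<open>The answer to one query has an entry for every agent: a flag telling whether the agent
  belongs to the chosen set, and the query point, the sample, the loss and the stochastic gradient.
  The last four are fixed dummies for agents that were not chosen.\<close>

type_synonym answer = "nat \<Rightarrow> bool \<times> rvec \<times> rvec \<times> real \<times> rvec"

definition answer_space :: "nat \<Rightarrow> nat \<Rightarrow> nat \<Rightarrow> answer measure" where
  "answer_space N d D = (\<Pi>\<^sub>M i\<in>{1..N}.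
     count_space UNIV \<Otimes>\<^sub>M Rn_borel d \<Otimes>\<^sub>M Rn_borel D \<Otimes>\<^sub>M borel \<Otimes>\<^sub>M Rn_borel d)"

definition oracle_answer ::
  "nat \<Rightarrow> nat \<Rightarrow> nat \<Rightarrow> problem \<Rightarrow> nat set \<Rightarrow> (nat \<Rightarrow> rvec) \<Rightarrow> (nat \<Rightarrow> rvec) \<Rightarrow> answer" where
  "oracle_answer N d D P S x \<xi> = (\<lambda>i\<in>{1..N}.
     if i \<in> S then (True, x i, \<xi> i, loss P (x i) (\<xi> i), sgrad P (x i) (\<xi> i))
     else (False, zero_vec d, zero_vec D, 0, zero_vec d))"

text \<open>An algorithm for a fixed budget draws a private random seed once. The query in round \<open>k\<close>
  (counted from 0) is a function of the seed and of the answers in rounds \<open>0, \<dots>, k - 1\<close>;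
  a real seed realizes every randomized choice, as all spaces involved are standard Borel.\<close>

record algorithm =
  seed :: "real measure"
  query :: "nat \<Rightarrow> real \<times> (nat \<Rightarrow> answer) \<Rightarrow> nat \<Rightarrow> rvec"
  returned :: "real \<times> (nat \<Rightarrow> answer) \<Rightarrow> nat \<Rightarrow> rvec"

definition valid_algorithm :: "nat \<Rightarrow> nat \<Rightarrow> nat \<Rightarrow> nat \<Rightarrow> algorithm \<Rightarrow> bool" where
  "valid_algorithm N d D K A \<longleftrightarrow>
     prob_space (seed A) \<and> sets (seed A) = sets borel \<and>
     (\<forall>k<K. query A k
        \<in> borel \<Otimes>\<^sub>M (\<Pi>\<^sub>M l\<in>{..<k}. answer_space N d D) \<rightarrow>\<^sub>M (\<Pi>\<^sub>M i\<in>{1..N}. Rn_borel d)) \<and>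
     returned A
        \<in> borel \<Otimes>\<^sub>M (\<Pi>\<^sub>M l\<in>{..<K}. answer_space N d D) \<rightarrow>\<^sub>M (\<Pi>\<^sub>M i\<in>{1..N}. Rn_borel d)"

text \<open>\<open>\<omega> k\<close> is the pair of the set of agents chosen in round \<open>k\<close> and the samples
  \<open>\<xi> i\<close> of all agents \<open>i\<close> in that round, of which only those of the chosen agents are
  revealed.\<close>

primrec history ::
  "nat \<Rightarrow> nat \<Rightarrow> nat \<Rightarrow> problem \<Rightarrow> algorithm \<Rightarrow> real \<Rightarrow> (nat \<Rightarrow> nat set \<times> (nat \<Rightarrow> rvec))
    \<Rightarrow> nat \<Rightarrow> nat \<Rightarrow> answer" where
  "history N d D P A u \<omega> 0 = (\<lambda>_. undefined)"
| "history N d D P A u \<omega> (Suc k) = (history N d D P A u \<omega> k)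
     (k := oracle_answer N d D P (fst (\<omega> k))
             (query A k (u, history N d D P A u \<omega> k)) (snd (\<omega> k)))"

definition run_space ::
  "oracle_kind \<Rightarrow> nat \<Rightarrow> nat \<Rightarrow> problem \<Rightarrow> algorithm
    \<Rightarrow> (real \<times> (nat \<Rightarrow> nat set \<times> (nat \<Rightarrow> rvec))) measure" where
  "run_space orc N K P A = seed A \<Otimes>\<^sub>M
     (\<Pi>\<^sub>M k\<in>{..<K}. measure_pmf (agent_choice orc N) \<Otimes>\<^sub>M (\<Pi>\<^sub>M i\<in>{1..N}. sample_dist P i))"

definition expected_gap ::
  "oracle_kind \<Rightarrow> nat \<Rightarrow> nat \<Rightarrow> nat \<Rightarrow> nat \<Rightarrow> algorithm \<Rightarrow> problem \<Rightarrow> nat \<Rightarrow> ennreal" where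
  "expected_gap orc N d D K A P i =
     (\<integral>\<^sup>+(u, \<omega>). ennreal (objective P i (returned A (u, history N d D P A u \<omega> K) i)
                      - (INF x\<in>Rn d. objective P i x)) \<partial>run_space orc N K P A)"

text \<open>A learning method provides an algorithm \<open>M T\<close> for each sample budget \<open>T\<close>; only the
  budgets that correspond to a whole number \<open>K\<close> of oracle calls matter.\<close>

definition learning_methods :: "oracle_kind \<Rightarrow> nat \<Rightarrow> nat \<Rightarrow> nat \<Rightarrow> (nat \<Rightarrow> algorithm) set" where
  "learning_methods orc N d D = {M. \<forall>K. valid_algorithm N d D K (M (samples_used orc N K))}"

text \<open>The sample complexity is the least positive budget from which on the expected error is at
  most \<open>\<epsilon>\<close>. Asking for this at a single budget only would be met, for every problem of a
  class and without looking at any sample, by a method that returns the points of a finite net one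
  after the other as the budget grows.\<close>

definition sample_complexity ::
  "oracle_kind \<Rightarrow> nat \<Rightarrow> nat \<Rightarrow> nat \<Rightarrow> real \<Rightarrow> (nat \<Rightarrow> algorithm) \<Rightarrow> problem \<Rightarrow> nat \<Rightarrow> ereal" where
  "sample_complexity orc N d D \<epsilon> M P i =
     Inf {ereal (real (samples_used orc N K)) | K. samples_used orc N K \<ge> 1 \<and>
       (\<forall>K'\<ge>K. expected_gap orc N d D K' (M (samples_used orc N K')) P i \<le> ennreal \<epsilon>)}"

definition num_close :: "nat \<Rightarrow> real \<Rightarrow> (nat \<Rightarrow> nat \<Rightarrow> real) \<Rightarrow> nat \<Rightarrow> nat" where
  "num_close N \<epsilon> b i = (\<Sum>j=1..N. of_bool (b i j \<le> \<epsilon>))"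

end

theory Submission
  imports Defs
begin

text \<open>
  Both bounds come from one two-point argument. Two problems with the same loss are built whose
  sample laws for agent \<open>j\<close> are coins of opposite biases \<open>t j\<close> and \<open>- t j\<close>. They pull the minimizer of
  agent \<open>i\<close> in opposite directions, so far apart that no point is good for both: the two excess risks
  of any point add up to at least \<open>4 * \<epsilon>\<close>. An algorithm that is \<open>\<epsilon>\<close>-accurate on both must
  therefore be able to tell them apart.

  Only the agents \<open>j\<close> with \<open>b i j < 4 * \<epsilon>\<close>, and agent \<open>i\<close> itself, receive a biased coin. The conditions
  imposed by \<open>b\<close> allow a drift of agent \<open>i\<close> by \<open>4 * \<epsilon>\<close> that decreases to zero with the distance
  \<open>b i j\<close>, at a rate limited by the triangle inequality (\<open>proximity_weights\<close>). The bias is of order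
  \<open>\<epsilon> / (r * B)\<close> in the convex case (\<open>wall_coin_problem\<close>: a flat valley tilted by the coins) and
  \<open>sqrt \<epsilon> / (r * \<sigma>)\<close> in the strongly convex case (\<open>quadratic_coin_problem\<close>: translates of one
  quadratic). A revealed coin of bias \<open>t\<close> lowers the affinity of the two hypotheses by at most \<open>t\<^sup>2\<close>,
  and of \<open>T\<close> samples a share of \<open>1 / N\<close> goes to each agent in the mean. So the hypotheses remain
  indistinguishable while \<open>T * n * t\<^sup>2 / N\<close> is below a small constant, \<open>n\<close> being the number of informed
  agents; solving for \<open>T\<close> gives the two bounds.

  Adaptivity of the algorithm causes no difficulty. All samples, revealed or not, are drawn in advance
  from a product measure, and because loss and gradients are common to both problems the returned
  point is one and the same function of them (\<open>history_problem_cong\<close>). This function depends only on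
  the samples of the agents drawn (\<open>history_cong\<close>), so the likelihood ratio can be restricted to them:
  the factors of the samples that stay hidden integrate to 1. This is a change of measure for
  integrands that are blind to part of each coordinate (\<open>nn_integral_PiM_change\<close>), applied first to the
  agents of one round and then to the rounds (\<open>nn_integral_rounds_density\<close>). The lemma
  \<open>two_point_rounds\<close> then bounds the sum of the two errors from below, and
  \<open>sample_complexity_class_ge\<close> turns this into a bound on the sample complexity.
\<close>

section \<open>Change of measure on products\<close>

text \<open>The integrand is blind to part of each coordinate; \<open>E i\<close> relates the points that it cannot
  distinguish in coordinate \<open>i\<close>. If \<open>w i\<close> turns integration against \<open>M' i\<close> into integration
  against \<open>M i\<close> only for functions that respect \<open>E i\<close>, then the product of the \<open>w i\<close> does the
  same for the product measures: integrating out one coordinate preserves blindness in the others,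
  so the coordinates can be exchanged one after the other. It is used once for the agents within a
  round and once for the sequence of rounds.\<close>

lemma nn_integral_PiM_change:
  fixes M M' :: "'i \<Rightarrow> 'a measure" and w :: "'i \<Rightarrow> 'a \<Rightarrow> ennreal"
  assumes "finite I"
    and sf: "\<And>i. sigma_finite_measure (M i)" "\<And>i. sigma_finite_measure (M' i)"
    and sets: "\<And>i. sets (M' i) = sets (M i)"
    and w[measurable]: "\<And>i. i \<in> I \<Longrightarrow> w i \<in> borel_measurable (M i)"
    and change: "\<And>i g. i \<in> I \<Longrightarrow> g \<in> borel_measurable (M i) \<Longrightarrow>
      (\<And>x y. x \<in> space (M i) \<Longrightarrow> y \<in> space (M i) \<Longrightarrow> E i x y \<Longrightarrow> g x = (g y :: ennreal)) \<Longrightarrow>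
      (\<integral>\<^sup>+x. g x \<partial>M' i) = (\<integral>\<^sup>+x. g x * w i x \<partial>M i)"
    and F: "F \<in> borel_measurable (PiM I M)"
    and inv: "\<And>i p x y. i \<in> I \<Longrightarrow> p \<in> space (PiM I M) \<Longrightarrow> x \<in> space (M i) \<Longrightarrow>
      y \<in> space (M i) \<Longrightarrow> E i x y \<Longrightarrow> F (p(i := x)) = F (p(i := y))"
  shows "(\<integral>\<^sup>+p. F p \<partial>PiM I M') = (\<integral>\<^sup>+p. F p * (\<Prod>i\<in>I. w i (p i)) \<partial>PiM I M)"
proof -
  interpret M: product_sigma_finite M by (simp add: product_sigma_finite_def sf)
  interpret M': product_sigma_finite M' by (simp add: product_sigma_finite_def sf)
  have spaces: "space (M' i) = space (M i)" for i
    using sets by (rule sets_eq_imp_space_eq)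
  have sets_PiM: "sets (PiM J M') = sets (PiM J M)" for J
    by (intro sets_PiM_cong refl sets)
  show ?thesis
    using assms(1) w change F inv
  proof (induction I arbitrary: F rule: finite_induct)
    case empty
    show ?case
      by (simp add: PiM_empty nn_integral_count_space_finite)
  next
    case (insert k I)
    note [measurable] = insert.prems(1,3)
    note mcong [measurable_cong] = sets_PiM[of "insert k I"] sets_PiM[of I] sets[of k]
    have [measurable]: "F \<in> borel_measurable (PiM (insert k I) M')"
      by measurable
    define H where "H p = (\<integral>\<^sup>+y. F (p(k := y)) * w k y \<partial>M k)" for p
    have [measurable]: "w k \<in> borel_measurable (M k)" by simp
    have H[measurable]: "H \<in> borel_measurable (PiM I M)"
      unfolding H_def by measurable
    have sec: "(\<lambda>y. F (p(k := y))) \<in> borel_measurable (M k)" if "p \<in> space (PiM I M)" for p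
      using measurable_component_update[OF that insert.hyps(2)] by measurable
    have "(\<integral>\<^sup>+p. F p \<partial>PiM (insert k I) M') = (\<integral>\<^sup>+p. (\<integral>\<^sup>+y. F (p(k := y)) \<partial>M' k) \<partial>PiM I M')"
      by (rule M'.product_nn_integral_insert) (use insert.hyps in simp_all)
    also have "\<dots> = (\<integral>\<^sup>+p. H p \<partial>PiM I M')"
    proof (rule nn_integral_cong)
      fix p assume "p \<in> space (PiM I M')"
      then have p: "p \<in> space (PiM I M)" by (simp add: space_PiM spaces)
      show "(\<integral>\<^sup>+y. F (p(k := y)) \<partial>M' k) = H p"
        unfolding H_def
      proof (rule insert.prems(2))
        show "F (p(k := x)) = F (p(k := y))"
          if "x \<in> space (M k)" "y \<in> space (M k)" "E k x y" for x y
        proof -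
          have "p(k := x) \<in> space (PiM (insert k I) M)"
            using p that(1) by (auto simp: space_PiM intro!: PiE_fun_upd)
          from insert.prems(4)[OF _ this that] show ?thesis by (simp only: fun_upd_upd insertI1)
        qed
      qed (use sec[OF p] in simp_all)
    qed
    also have "\<dots> = (\<integral>\<^sup>+p. H p * (\<Prod>i\<in>I. w i (p i)) \<partial>PiM I M)"
    proof (rule insert.IH)
      fix i p x y
      assume *: "i \<in> I" "p \<in> space (PiM I M)" "x \<in> space (M i)" "y \<in> space (M i)" "E i x y"
      then have "i \<noteq> k" using insert.hyps by auto
      show "H (p(i := x)) = H (p(i := y))"
        unfolding H_def
      proof (rule nn_integral_cong)
        fix z assume z: "z \<in> space (M k)"
        have "p(k := z) \<in> space (PiM (insert k I) M)"
          using * z by (auto simp: space_PiM intro!: PiE_fun_upd)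
        then have "F (p(k := z, i := x)) = F (p(k := z, i := y))"
          by (rule insert.prems(4)[OF insertI2[OF *(1)] _ *(3-5)])
        then show "F (p(i := x, k := z)) * w k z = F (p(i := y, k := z)) * w k z"
          unfolding fun_upd_twist[OF \<open>i \<noteq> k\<close>] by (rule arg_cong)
      qed
    qed (use insert.prems(1,2) H in auto)
    also have "\<dots> = (\<integral>\<^sup>+p. (\<integral>\<^sup>+y. F (p(k := y)) * (\<Prod>i\<in>insert k I. w i ((p(k := y)) i)) \<partial>M k) \<partial>PiM I M)"
    proof (rule nn_integral_cong)
      fix p assume p: "p \<in> space (PiM I M)"
      have "H p * (\<Prod>i\<in>I. w i (p i)) = (\<integral>\<^sup>+y. F (p(k := y)) * w k y * (\<Prod>i\<in>I. w i (p i)) \<partial>M k)"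
        unfolding H_def
        by (intro nn_integral_multc[symmetric] borel_measurable_times_ennreal sec[OF p]) simp
      also have "\<dots> = (\<integral>\<^sup>+y. F (p(k := y)) * (\<Prod>i\<in>insert k I. w i ((p(k := y)) i)) \<partial>M k)"
      proof (rule nn_integral_cong)
        fix y
        have "(\<Prod>i\<in>I. w i ((p(k := y)) i)) = (\<Prod>i\<in>I. w i (p i))"
          using insert.hyps(2) by (intro prod.cong) auto
        then show "F (p(k := y)) * w k y * (\<Prod>i\<in>I. w i (p i)) =
            F (p(k := y)) * (\<Prod>i\<in>insert k I. w i ((p(k := y)) i))"
          using insert.hyps by (simp add: mult.assoc)
      qed
      finally show "H p * (\<Prod>i\<in>I. w i (p i)) = \<dots>" .
    qed
    also have "\<dots> = (\<integral>\<^sup>+p. F p * (\<Prod>i\<in>insert k I. w i (p i)) \<partial>PiM (insert k I) M)"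
      by (rule M.product_nn_integral_insert[symmetric]) (use insert.hyps in simp_all)
    finally show ?case .
  qed
qed

text \<open>A coordinate that is not revealed contributes the total mass 1 under both measures, hence no
  factor to the likelihood ratio.\<close>

lemma nn_integral_PiM_density_revealed:
  fixes M :: "'i \<Rightarrow> 'a measure" and l :: "'i \<Rightarrow> 'a \<Rightarrow> ennreal"
  assumes "finite I"
    and M: "\<And>i. prob_space (M i)"
    and l[measurable]: "\<And>i. l i \<in> borel_measurable (M i)"
    and Ml: "\<And>i. prob_space (density (M i) (l i))"
    and F: "F \<in> borel_measurable (PiM I M)"
    and inv: "\<And>x y. x \<in> space (PiM I M) \<Longrightarrow> y \<in> space (PiM I M) \<Longrightarrow>
      (\<And>i. i \<in> I \<Longrightarrow> i \<in> S \<Longrightarrow> x i = y i) \<Longrightarrow> F x = (F y :: ennreal)"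
  shows "(\<integral>\<^sup>+x. F x \<partial>PiM I (\<lambda>i. density (M i) (l i))) =
    (\<integral>\<^sup>+x. F x * (\<Prod>i\<in>I. if i \<in> S then l i (x i) else 1) \<partial>PiM I M)"
proof -
  define w where "w i = (if i \<in> S then l i else (\<lambda>_. 1))" for i
  have "(\<integral>\<^sup>+x. F x \<partial>PiM I (\<lambda>i. density (M i) (l i))) =
      (\<integral>\<^sup>+x. F x * (\<Prod>i\<in>I. w i (x i)) \<partial>PiM I M)"
  proof (rule nn_integral_PiM_change[where E = "\<lambda>i x y. i \<in> S \<longrightarrow> x = y"])
    fix i g
    assume g[measurable]: "g \<in> borel_measurable (M i)"
      and ginv: "\<And>x y. x \<in> space (M i) \<Longrightarrow> y \<in> space (M i) \<Longrightarrow> i \<in> S \<longrightarrow> x = y \<Longrightarrow> g x = (g y :: ennreal)"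
    interpret M: prob_space "M i" by (rule M)
    interpret Ml: prob_space "density (M i) (l i)" by (rule Ml)
    show "(\<integral>\<^sup>+x. g x \<partial>density (M i) (l i)) = (\<integral>\<^sup>+x. g x * w i x \<partial>M i)"
    proof (cases "i \<in> S")
      case True
      then show ?thesis by (simp add: nn_integral_density w_def mult.commute)
    next
      case False
      obtain x0 where x0: "x0 \<in> space (M i)" using M.not_empty by blast
      have const: "g x = g x0" if "x \<in> space (M i)" for x
        using that x0 False by (intro ginv) auto
      have "(\<integral>\<^sup>+x. g x \<partial>density (M i) (l i)) = (\<integral>\<^sup>+x. g x0 \<partial>density (M i) (l i))"
        by (intro nn_integral_cong) (simp add: const)
      also have "\<dots> = (\<integral>\<^sup>+x. g x0 \<partial>M i)"
        by (simp add: M.emeasure_space_1 Ml.emeasure_space_1[simplified])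
      also have "\<dots> = (\<integral>\<^sup>+x. g x * w i x \<partial>M i)"
        using False by (intro nn_integral_cong) (simp add: const w_def)
      finally show ?thesis .
    qed
  next
    fix i p x y
    assume *: "i \<in> I" "p \<in> space (PiM I M)" "x \<in> space (M i)" "y \<in> space (M i)" "i \<in> S \<longrightarrow> x = y"
    show "F (p(i := x)) = F (p(i := y))"
      using * by (intro inv) (auto simp: space_PiM PiE_iff extensional_def)
  qed (use assms in \<open>auto simp: w_def prob_space_imp_sigma_finite\<close>)
  also have "\<dots> = (\<integral>\<^sup>+x. F x * (\<Prod>i\<in>I. if i \<in> S then l i (x i) else 1) \<partial>PiM I M)"
    unfolding w_def by (intro nn_integral_cong arg_cong2[where f = times] prod.cong refl) auto
  finally show ?thesis .
qed

text \<open>The law of the drawn agents and of all samples over \<open>K\<close> rounds, and the likelihood ratio of what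
  is revealed: a sample contributes its density only if its agent was drawn in that round.\<close>

definition rounds :: "'i set pmf \<Rightarrow> 'i set \<Rightarrow> ('i \<Rightarrow> 'a measure) \<Rightarrow> nat
    \<Rightarrow> (nat \<Rightarrow> 'i set \<times> ('i \<Rightarrow> 'a)) measure" where
  "rounds C I M K = (\<Pi>\<^sub>M k\<in>{..<K}. measure_pmf C \<Otimes>\<^sub>M PiM I M)"

definition revealed_weight ::
  "('i \<Rightarrow> 'a \<Rightarrow> 'b) \<Rightarrow> 'i set \<Rightarrow> nat \<Rightarrow> (nat \<Rightarrow> 'i set \<times> ('i \<Rightarrow> 'a)) \<Rightarrow> 'b::comm_semiring_1" where
  "revealed_weight l I K p = (\<Prod>k<K. \<Prod>i\<in>I. if i \<in> fst (p k) then l i (snd (p k) i) else 1)"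

lemma prob_space_rounds:
  assumes "\<And>i. prob_space (M i)"
  shows "prob_space (rounds C I M K)"
proof -
  have "prob_space (measure_pmf C \<Otimes>\<^sub>M PiM I M)"
    by (intro prob_space_pair measure_pmf.prob_space_axioms prob_space_PiM assms)
  then show ?thesis unfolding rounds_def by (intro prob_space_PiM)
qed

lemma measurable_if_mem_fst[measurable]:
  assumes "f \<in> borel_measurable M"
  shows "(\<lambda>a. if i \<in> fst a then f (snd a) else (c :: 'b :: topological_space))
    \<in> borel_measurable (measure_pmf C \<Otimes>\<^sub>M M)"
proof -
  have "Measurable.pred (measure_pmf C \<Otimes>\<^sub>M M) (\<lambda>a. i \<in> fst a)"
    by (rule measurable_compose[OF measurable_fst]) simp
  then show ?thesis using assms by measurable
qed

lemma measurable_revealed_weight: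
  fixes l :: "'i \<Rightarrow> 'a \<Rightarrow> real"
  assumes [measurable]: "\<And>i. l i \<in> borel_measurable (M i)"
  shows "revealed_weight l I K \<in> borel_measurable (rounds C I M K)"
proof -
  have "(\<lambda>p. if i \<in> fst (p k) then l i (snd (p k) i) else 1) \<in> borel_measurable (rounds C I M K)"
    if "k < K" "i \<in> I" for k i
  proof (rule measurable_compose[where f = "\<lambda>p. p k"])
    show "(\<lambda>p. p k) \<in> rounds C I M K \<rightarrow>\<^sub>M (measure_pmf C \<Otimes>\<^sub>M PiM I M)"
      unfolding rounds_def using that by (intro measurable_component_singleton) simp
    show "(\<lambda>a. if i \<in> fst a then l i (snd a i) else 1)
        \<in> borel_measurable (measure_pmf C \<Otimes>\<^sub>M PiM I M)"
      using that by (intro measurable_if_mem_fst) measurable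
  qed
  then show ?thesis unfolding revealed_weight_def[abs_def]
    by (intro borel_measurable_prod) auto
qed

text \<open>Since the sample used in each round is fixed before the algorithm runs, an adaptive algorithm
  is just a function on a product space. The change of measure therefore needs no conditioning on
  the past: it suffices that the integrand does not depend on the samples of agents not drawn.\<close>

lemma nn_integral_rounds_density:
  fixes M :: "'i \<Rightarrow> 'a measure" and l :: "'i \<Rightarrow> 'a \<Rightarrow> real"
  assumes I: "finite I"
    and M: "\<And>i. prob_space (M i)"
    and l[measurable]: "\<And>i. l i \<in> borel_measurable (M i)"
    and nonneg: "\<And>i x. 0 \<le> l i x"
    and Ml: "\<And>i. prob_space (density (M i) (\<lambda>x. ennreal (l i x)))"
    and F: "F \<in> borel_measurable (rounds C I M K)"
    and inv: "\<And>p q. p \<in> space (rounds C I M K) \<Longrightarrow> q \<in> space (rounds C I M K) \<Longrightarrow>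
      (\<And>k. k < K \<Longrightarrow> fst (p k) = fst (q k)) \<Longrightarrow>
      (\<And>k i. k < K \<Longrightarrow> i \<in> I \<Longrightarrow> i \<in> fst (p k) \<Longrightarrow> snd (p k) i = snd (q k) i) \<Longrightarrow> F p = F q"
  shows "(\<integral>\<^sup>+p. F p \<partial>rounds C I (\<lambda>i. density (M i) (\<lambda>x. ennreal (l i x))) K) =
    (\<integral>\<^sup>+p. F p * ennreal (revealed_weight l I K p) \<partial>rounds C I M K)"
proof -
  have "(\<integral>\<^sup>+p. F p \<partial>rounds C I (\<lambda>i. density (M i) (\<lambda>x. ennreal (l i x))) K) =
    (\<integral>\<^sup>+p. F p * (\<Prod>k<K. \<Prod>i\<in>I. if i \<in> fst (p k) then ennreal (l i (snd (p k) i)) else 1) \<partial>rounds C I M K)"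
    unfolding rounds_def
  proof (rule nn_integral_PiM_change[where
        E = "\<lambda>_ a b. fst a = fst b \<and> (\<forall>i\<in>I. i \<in> fst a \<longrightarrow> snd a i = snd b i)"])
    interpret PM: prob_space "PiM I M" by (intro prob_space_PiM M)
    interpret PMl: prob_space "PiM I (\<lambda>i. density (M i) (\<lambda>x. ennreal (l i x)))" by (intro prob_space_PiM Ml)
    have sets_eq: "sets (PiM I (\<lambda>i. density (M i) (\<lambda>x. ennreal (l i x)))) = sets (PiM I M)"
      by (intro sets_PiM_cong) auto
    show "sigma_finite_measure (measure_pmf C \<Otimes>\<^sub>M PiM I M)"
      "sigma_finite_measure (measure_pmf C \<Otimes>\<^sub>M PiM I (\<lambda>i. density (M i) (\<lambda>x. ennreal (l i x))))"
      by (intro prob_space_imp_sigma_finite prob_space_pair measure_pmf.prob_space_axioms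
          PM.prob_space_axioms PMl.prob_space_axioms)+
    show "sets (measure_pmf C \<Otimes>\<^sub>M PiM I (\<lambda>i. density (M i) (\<lambda>x. ennreal (l i x)))) = sets (measure_pmf C \<Otimes>\<^sub>M PiM I M)"
      by (intro sets_pair_measure_cong sets_eq refl)
    show "(\<lambda>a. \<Prod>i\<in>I. if i \<in> fst a then ennreal (l i (snd a i)) else 1) \<in> borel_measurable (measure_pmf C \<Otimes>\<^sub>M PiM I M)"
      using measurable_if_mem_fst[where M = "PiM I M" and f = "\<lambda>x. ennreal (l _ (x _))"]
      by (intro borel_measurable_prod_ennreal) simp
    show "F \<in> borel_measurable (PiM {..<K} (\<lambda>_. measure_pmf C \<Otimes>\<^sub>M PiM I M))"
      using F unfolding rounds_def .
    show "F (p(k := a)) = F (p(k := b))"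
      if "k \<in> {..<K}" "p \<in> space (PiM {..<K} (\<lambda>_. measure_pmf C \<Otimes>\<^sub>M PiM I M))"
        "a \<in> space (measure_pmf C \<Otimes>\<^sub>M PiM I M)" "b \<in> space (measure_pmf C \<Otimes>\<^sub>M PiM I M)"
        "fst a = fst b \<and> (\<forall>i\<in>I. i \<in> fst a \<longrightarrow> snd a i = snd b i)" for k p a b
      using that by (intro inv) (auto simp: rounds_def space_PiM PiE_iff extensional_def)
    fix k :: nat and g :: "'i set \<times> ('i \<Rightarrow> 'a) \<Rightarrow> ennreal"
    assume g: "g \<in> borel_measurable (measure_pmf C \<Otimes>\<^sub>M PiM I M)"
      and ginv: "\<And>a b. a \<in> space (measure_pmf C \<Otimes>\<^sub>M PiM I M) \<Longrightarrow>
        b \<in> space (measure_pmf C \<Otimes>\<^sub>M PiM I M) \<Longrightarrow>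
        fst a = fst b \<and> (\<forall>i\<in>I. i \<in> fst a \<longrightarrow> snd a i = snd b i) \<Longrightarrow> g a = g b"
    note [measurable] = g
    have g': "g \<in> borel_measurable (measure_pmf C \<Otimes>\<^sub>M PiM I (\<lambda>i. density (M i) (\<lambda>x. ennreal (l i x))))"
      using g by (simp cong: measurable_cong_sets sets_pair_measure_cong add: sets_eq)
    have "(\<integral>\<^sup>+a. g a \<partial>(measure_pmf C \<Otimes>\<^sub>M PiM I (\<lambda>i. density (M i) (\<lambda>x. ennreal (l i x))))) =
        (\<integral>\<^sup>+S. (\<integral>\<^sup>+x. g (S, x) \<partial>PiM I (\<lambda>i. density (M i) (\<lambda>x. ennreal (l i x)))) \<partial>measure_pmf C)"
      by (rule PMl.nn_integral_fst[symmetric, OF g'])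
    also have "\<dots> = (\<integral>\<^sup>+S. (\<integral>\<^sup>+x. g (S, x) * (\<Prod>i\<in>I. if i \<in> S then ennreal (l i (x i)) else 1) \<partial>PiM I M) \<partial>measure_pmf C)"
    proof (intro nn_integral_cong nn_integral_PiM_density_revealed I M l Ml)
      show "(\<lambda>x. g (S, x)) \<in> borel_measurable (PiM I M)" for S
        by (rule measurable_compose[OF _ g]) simp
    qed (auto intro!: ginv simp: space_pair_measure)
    also have "\<dots> = (\<integral>\<^sup>+a. g a * (\<Prod>i\<in>I. if i \<in> fst a then ennreal (l i (snd a i)) else 1) \<partial>(measure_pmf C \<Otimes>\<^sub>M PiM I M))"
    proof (subst PM.nn_integral_fst[symmetric])
      show "(\<lambda>a. g a * (\<Prod>i\<in>I. if i \<in> fst a then ennreal (l i (snd a i)) else 1))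
          \<in> borel_measurable (measure_pmf C \<Otimes>\<^sub>M PiM I M)"
        using measurable_if_mem_fst[where M = "PiM I M" and f = "\<lambda>x. ennreal (l _ (x _))"]
        by (intro borel_measurable_times_ennreal borel_measurable_prod_ennreal g) simp
    qed (simp only: fst_conv snd_conv)
    finally show "(\<integral>\<^sup>+a. g a \<partial>(measure_pmf C \<Otimes>\<^sub>M PiM I (\<lambda>i. density (M i) (\<lambda>x. ennreal (l i x))))) = \<dots>" .
  qed simp_all
  also have "\<dots> = (\<integral>\<^sup>+p. F p * ennreal (revealed_weight l I K p) \<partial>rounds C I M K)"
    unfolding revealed_weight_def
    by (intro nn_integral_cong arg_cong2[where f = times] refl)
      (simp add: nonneg prod_nonneg flip: prod_ennreal, auto intro!: prod.cong)
  finally show ?thesis .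
qed

section \<open>The two-point bound for a sequence of rounds\<close>

text \<open>For likelihood ratios \<open>a\<close> and \<open>b\<close>, both of mean 1, the mean of \<open>min a b\<close> is one minus the total
  variation distance. It is bounded here through the Hellinger affinity, the mean of
  \<open>sqrt (a * b)\<close>, which is at least \<open>a * b\<close> and hence at least \<open>1 - v\<close>. Taking means in this
  inequality gives that the mean of \<open>min a b\<close> is at least \<open>3/4 - 2 * v\<close>, which exceeds \<open>1/2\<close> for
  small \<open>v\<close>.\<close>

lemma min_ge_of_prod:
  fixes a b v :: real
  assumes "0 \<le> a" "0 \<le> b" "a * b \<le> 1" "1 - v \<le> a * b"
  shows "2 \<le> min a b + 5 / 8 * (a + b) + 2 * v"
proof -
  have *: "2 * (x * y) \<le> x + 5 / 8 * (x + y)" if "0 \<le> x" "x \<le> y" "x * y \<le> 1" for x y :: real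
  proof -
    have "(x * y)\<^sup>2 \<le> x * y"
      using that by (simp add: power2_eq_square mult_left_le)
    then have "x * y \<le> sqrt (x * y)" by (rule real_le_rsqrt)
    also have "\<dots> = sqrt x * sqrt y" by (rule real_sqrt_mult)
    finally have 1: "2 * (x * y) \<le> 2 * (sqrt x * sqrt y)" by simp
    have sq: "(13 * u - 8 * w)\<^sup>2 = 169 * u\<^sup>2 + 64 * w\<^sup>2 - 208 * (u * w)" for u w :: real
      by (simp add: power2_eq_square algebra_simps)
    \<comment> \<open>The claim is that the quadratic form \<open>13 / 8 * p\<^sup>2 - 2 * p * q + 5 / 8 * q\<^sup>2\<close> in the square
      roots is non-negative; it is so since its discriminant \<open>4 - 65 / 16\<close> is negative. The square
      below witnesses it with \<open>64 / 104 \<le> 5 / 8\<close> as coefficient of \<open>q\<^sup>2\<close>.\<close>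
    have "0 \<le> (13 * sqrt x - 8 * sqrt y)\<^sup>2" by simp
    also have "\<dots> = 169 * (sqrt x)\<^sup>2 + 64 * (sqrt y)\<^sup>2 - 208 * (sqrt x * sqrt y)"
      by (rule sq)
    also have "\<dots> = 169 * x + 64 * y - 208 * (sqrt x * sqrt y)" using that by simp
    finally have "208 * (sqrt x * sqrt y) \<le> 169 * x + 64 * y" by simp
    then have "2 * c \<le> x + 5 / 8 * (x + y)" if "c = sqrt x * sqrt y" for c
      unfolding that[symmetric] using \<open>0 \<le> x\<close> \<open>x \<le> y\<close> by (simp add: field_simps)
    with 1 show ?thesis by fastforce
  qed
  show ?thesis
    using *[of a b] *[of b a] assms by (cases "a \<le> b") (auto simp: min_def mult.commute algebra_simps)
qed

lemma revealed_weight_nonneg: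
  "(\<And>i x. 0 \<le> l i x) \<Longrightarrow> 0 \<le> (revealed_weight l I K p :: real)"
  unfolding revealed_weight_def by (intro prod_nonneg) auto

text \<open>The product of two likelihood ratios stays close to 1 as long as few informative samples have
  been revealed: the loss is at most additive, by the Weierstrass product inequality.\<close>

lemma revealed_weight_prod_bounds:
  fixes l1 l2 :: "'i \<Rightarrow> 'a \<Rightarrow> real"
  assumes "finite I" and nonneg: "\<And>i x. 0 \<le> l1 i x" "\<And>i x. 0 \<le> l2 i x"
    and le: "\<And>i x. l1 i x * l2 i x \<le> 1" and ge: "\<And>i x. 1 - v i \<le> l1 i x * l2 i x"
  shows "revealed_weight l1 I K p * revealed_weight l2 I K p \<le> 1"
    and "1 - (\<Sum>k<K. \<Sum>i\<in>I. if i \<in> fst (p k) then v i else 0)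
      \<le> revealed_weight l1 I K p * revealed_weight l2 I K p"
proof -
  define q where "q = (\<lambda>(k, i). if i \<in> fst (p k) then l1 i (snd (p k) i) * l2 i (snd (p k) i) else 1)"
  have q01: "0 \<le> q z" "q z \<le> 1" for z
    using nonneg le by (auto simp: q_def split: prod.splits)
  have "revealed_weight l1 I K p * revealed_weight l2 I K p = (\<Prod>k<K. \<Prod>i\<in>I. q (k, i))"
    unfolding revealed_weight_def prod.distrib[symmetric] q_def by (intro prod.cong refl) auto
  also have "\<dots> = (\<Prod>z\<in>{..<K} \<times> I. q z)"
    by (simp add: prod.cartesian_product)
  finally have eq: "revealed_weight l1 I K p * revealed_weight l2 I K p = (\<Prod>z\<in>{..<K} \<times> I. q z)" .
  show "revealed_weight l1 I K p * revealed_weight l2 I K p \<le> 1"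
    unfolding eq using q01 by (intro prod_le_1) auto
  have "(\<Sum>z\<in>{..<K} \<times> I. 1 - q z) \<le> (\<Sum>(k, i)\<in>{..<K} \<times> I. if i \<in> fst (p k) then v i else 0)"
  proof (intro sum_mono, clarify)
    fix k i
    show "1 - q (k, i) \<le> (if i \<in> fst (p k) then v i else 0)"
      using ge[of i "snd (p k) i"] by (simp add: q_def)
  qed
  moreover have "1 - (\<Sum>z\<in>{..<K} \<times> I. 1 - q z) \<le> (\<Prod>z\<in>{..<K} \<times> I. 1 - (1 - q z))"
    using q01 by (intro Weierstrass_prod_ineq) auto
  ultimately show "1 - (\<Sum>k<K. \<Sum>i\<in>I. if i \<in> fst (p k) then v i else 0)
      \<le> revealed_weight l1 I K p * revealed_weight l2 I K p"
    unfolding eq by (simp add: sum.cartesian_product)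
qed

lemma nn_integral_rounds_sum:
  fixes M :: "'i \<Rightarrow> 'a measure" and h :: "'i set \<Rightarrow> ennreal"
  assumes M: "\<And>i. prob_space (M i)"
  shows "(\<integral>\<^sup>+p. (\<Sum>k<K. h (fst (p k))) \<partial>rounds C I M K) = of_nat K * (\<integral>\<^sup>+S. h S \<partial>measure_pmf C)"
proof -
  let ?R = "measure_pmf C \<Otimes>\<^sub>M PiM I M"
  interpret PM: prob_space "PiM I M" by (intro prob_space_PiM M)
  have R: "prob_space ?R"
    by (intro prob_space_pair measure_pmf.prob_space_axioms PM.prob_space_axioms)
  have hfst: "(\<lambda>a. h (fst a)) \<in> borel_measurable ?R"
    by (rule measurable_compose[OF measurable_fst]) simp
  have comp: "(\<lambda>p. p k) \<in> rounds C I M K \<rightarrow>\<^sub>M ?R" if "k < K" for k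
    unfolding rounds_def using that by (intro measurable_component_singleton) simp
  have "(\<integral>\<^sup>+p. h (fst (p k)) \<partial>rounds C I M K) = (\<integral>\<^sup>+S. h S \<partial>measure_pmf C)" if k: "k < K" for k
  proof -
    have "(\<integral>\<^sup>+p. h (fst (p k)) \<partial>rounds C I M K) = (\<integral>\<^sup>+a. h (fst a) \<partial>distr (rounds C I M K) ?R (\<lambda>p. p k))"
      using comp[OF k] hfst by (simp add: nn_integral_distr)
    also have "distr (rounds C I M K) ?R (\<lambda>p. p k) = ?R"
      unfolding rounds_def using R k by (intro distr_PiM_component) auto
    also have "(\<integral>\<^sup>+a. h (fst a) \<partial>?R) = (\<integral>\<^sup>+S. (\<integral>\<^sup>+x. h S \<partial>PiM I M) \<partial>measure_pmf C)"
      using PM.nn_integral_fst[OF hfst] by simp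
    finally show ?thesis by (simp add: PM.emeasure_space_1)
  qed
  moreover have "(\<integral>\<^sup>+p. (\<Sum>k<K. h (fst (p k))) \<partial>rounds C I M K) =
      (\<Sum>k<K. \<integral>\<^sup>+p. h (fst (p k)) \<partial>rounds C I M K)"
    using measurable_compose[OF comp hfst] by (intro nn_integral_sum) simp
  ultimately show ?thesis by simp
qed

text \<open>Le Cam's two-point argument. If the losses \<open>F1\<close> and \<open>F2\<close> cannot both be small on the same
  outcome, then the sum of their means under the two hypotheses is at least \<open>\<Delta>\<close> times the mean of the
  smaller likelihood ratio, and the budget keeps that mean above \<open>5/8\<close>. That this constant exceeds
  \<open>1/2\<close> matters: with \<open>\<Delta> = 4 * \<epsilon>\<close> the sum of the errors is then larger than \<open>2 * \<epsilon>\<close>.\<close>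

lemma two_point_rounds:
  fixes M :: "'i \<Rightarrow> 'a measure" and l1 l2 :: "'i \<Rightarrow> 'a \<Rightarrow> real"
  assumes I: "finite I"
    and M: "\<And>i. prob_space (M i)"
    and l1: "\<And>i. l1 i \<in> borel_measurable (M i)" "\<And>i x. 0 \<le> l1 i x"
      "\<And>i. prob_space (density (M i) (\<lambda>x. ennreal (l1 i x)))"
    and l2: "\<And>i. l2 i \<in> borel_measurable (M i)" "\<And>i x. 0 \<le> l2 i x"
      "\<And>i. prob_space (density (M i) (\<lambda>x. ennreal (l2 i x)))"
    and v: "\<And>i. 0 \<le> v i" "\<And>i x. l1 i x * l2 i x \<le> 1" "\<And>i x. 1 - v i \<le> l1 i x * l2 i x"
    and budget: "of_nat K * (\<integral>\<^sup>+S. ennreal (\<Sum>i\<in>I. if i \<in> S then v i else 0) \<partial>measure_pmf C) \<le> ennreal (1 / 16)"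
    and F1: "F1 \<in> borel_measurable (rounds C I M K)"
    and inv1: "\<And>p q. p \<in> space (rounds C I M K) \<Longrightarrow> q \<in> space (rounds C I M K) \<Longrightarrow>
      (\<And>k. k < K \<Longrightarrow> fst (p k) = fst (q k)) \<Longrightarrow>
      (\<And>k i. k < K \<Longrightarrow> i \<in> I \<Longrightarrow> i \<in> fst (p k) \<Longrightarrow> snd (p k) i = snd (q k) i) \<Longrightarrow> F1 p = F1 q"
    and F2: "F2 \<in> borel_measurable (rounds C I M K)"
    and inv2: "\<And>p q. p \<in> space (rounds C I M K) \<Longrightarrow> q \<in> space (rounds C I M K) \<Longrightarrow>
      (\<And>k. k < K \<Longrightarrow> fst (p k) = fst (q k)) \<Longrightarrow>
      (\<And>k i. k < K \<Longrightarrow> i \<in> I \<Longrightarrow> i \<in> fst (p k) \<Longrightarrow> snd (p k) i = snd (q k) i) \<Longrightarrow> F2 p = F2 q"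
    and sep: "\<And>p. p \<in> space (rounds C I M K) \<Longrightarrow> \<Delta> \<le> F1 p + F2 p"
  shows "ennreal (5 / 8) * \<Delta> \<le>
    (\<integral>\<^sup>+p. F1 p \<partial>rounds C I (\<lambda>i. density (M i) (\<lambda>x. ennreal (l1 i x))) K) +
    (\<integral>\<^sup>+p. F2 p \<partial>rounds C I (\<lambda>i. density (M i) (\<lambda>x. ennreal (l2 i x))) K)"
proof -
  let ?R = "rounds C I M K"
  interpret R: prob_space ?R by (rule prob_space_rounds[OF M])
  define W1 where "W1 = revealed_weight l1 I K"
  define W2 where "W2 = revealed_weight l2 I K"
  define V where "V p = (\<Sum>k<K. \<Sum>i\<in>I. if i \<in> fst (p k) then v i else 0)"
    for p :: "nat \<Rightarrow> 'i set \<times> ('i \<Rightarrow> 'a)"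
  have [measurable]: "W1 \<in> borel_measurable ?R" "W2 \<in> borel_measurable ?R"
    unfolding W1_def W2_def by (intro measurable_revealed_weight l1 l2)+
  note [measurable] = F1 F2
  have nonneg: "0 \<le> W1 p" "0 \<le> W2 p" "0 \<le> V p" for p
    using revealed_weight_nonneg[of l1] revealed_weight_nonneg[of l2] l1(2) l2(2) v(1)
    by (auto simp: W1_def W2_def V_def intro!: sum_nonneg)
  have one: "(\<integral>\<^sup>+p. ennreal (revealed_weight l I K p) \<partial>?R) = 1"
    if "\<And>i. l i \<in> borel_measurable (M i)" "\<And>i x. 0 \<le> l i x"
      "\<And>i. prob_space (density (M i) (\<lambda>x. ennreal (l i x)))" for l :: "'i \<Rightarrow> 'a \<Rightarrow> real"
  proof -
    interpret Rl: prob_space "rounds C I (\<lambda>i. density (M i) (\<lambda>x. ennreal (l i x))) K"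
      by (rule prob_space_rounds[OF that(3)])
    from nn_integral_rounds_density[where M = M and l = l and F = "\<lambda>_. 1" and C = C and K = K,
        OF I M that(1,2,3)] show ?thesis
      by (simp add: Rl.emeasure_space_1)
  qed
  define Emin where "Emin = (\<integral>\<^sup>+p. ennreal (min (W1 p) (W2 p)) \<partial>?R)"
  have EW: "(\<integral>\<^sup>+p. ennreal (W1 p) \<partial>?R) = 1" "(\<integral>\<^sup>+p. ennreal (W2 p) \<partial>?R) = 1"
    unfolding W1_def W2_def by (rule one; use l1 l2 in blast)+
  have V_sum: "ennreal (V p) = (\<Sum>k<K. ennreal (\<Sum>i\<in>I. if i \<in> fst (p k) then v i else 0))" for p
    unfolding V_def using v(1) by (intro sum_ennreal[symmetric] sum_nonneg) auto
  have EV: "(\<integral>\<^sup>+p. ennreal (V p) \<partial>?R) \<le> ennreal (1 / 16)"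
    unfolding V_sum using budget
    by (subst nn_integral_rounds_sum[OF M, where h = "\<lambda>S. ennreal (\<Sum>i\<in>I. if i \<in> S then v i else 0)"])
  have V_meas[measurable]: "(\<lambda>p. ennreal (V p)) \<in> borel_measurable ?R"
    unfolding V_sum
  proof (intro borel_measurable_sum)
    fix k assume k: "k \<in> {..<K}"
    show "(\<lambda>p. ennreal (\<Sum>i\<in>I. if i \<in> fst (p k) then v i else 0)) \<in> borel_measurable ?R"
    proof (rule measurable_compose[where f = "\<lambda>p. p k"])
      show "(\<lambda>p. p k) \<in> ?R \<rightarrow>\<^sub>M (measure_pmf C \<Otimes>\<^sub>M PiM I M)"
        unfolding rounds_def using k by (rule measurable_component_singleton)
      show "(\<lambda>a. ennreal (\<Sum>i\<in>I. if i \<in> fst a then v i else 0)) \<in> borel_measurable (measure_pmf C \<Otimes>\<^sub>M PiM I M)"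
        by (rule measurable_compose[OF measurable_fst]) simp
    qed
  qed
  have "ennreal 2 = (\<integral>\<^sup>+p. ennreal 2 \<partial>?R)" by (simp add: R.emeasure_space_1)
  also have "\<dots> \<le> (\<integral>\<^sup>+p. ennreal (min (W1 p) (W2 p)) + ennreal (5 / 8) * (ennreal (W1 p) + ennreal (W2 p))
      + 2 * ennreal (V p) \<partial>?R)"
  proof (rule nn_integral_mono)
    fix p
    have "2 \<le> min (W1 p) (W2 p) + 5 / 8 * (W1 p + W2 p) + 2 * V p"
      using nonneg[of p] revealed_weight_prod_bounds[where ?l1.0 = l1 and ?l2.0 = l2 and v = v and p = p and K = K,
          OF I l1(2) l2(2) v(2,3)]
      unfolding W1_def W2_def V_def by (intro min_ge_of_prod)
    then show "ennreal 2 \<le> ennreal (min (W1 p) (W2 p)) + ennreal (5 / 8) * (ennreal (W1 p) + ennreal (W2 p))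
        + 2 * ennreal (V p)"
      using nonneg[of p] by (simp flip: ennreal_plus ennreal_mult ennreal_numeral add: ennreal_leI)
  qed
  also have "\<dots> = Emin + ennreal (5 / 8) * (1 + 1) + 2 * (\<integral>\<^sup>+p. ennreal (V p) \<partial>?R)"
  proof -
    have "(\<lambda>p. ennreal (min (W1 p) (W2 p))) \<in> borel_measurable ?R"
      "(\<lambda>p. ennreal (W1 p)) \<in> borel_measurable ?R" "(\<lambda>p. ennreal (W2 p)) \<in> borel_measurable ?R"
      by measurable
    note m = this V_meas
    show ?thesis
      unfolding Emin_def by (simp only: EW nn_integral_add nn_integral_cmult m borel_measurable_add borel_measurable_const
          borel_measurable_times_ennreal)
  qed
  also have "\<dots> \<le> Emin + ennreal (5 / 8) * (1 + 1) + 2 * ennreal (1 / 16)"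
    by (intro add_left_mono mult_left_mono EV) auto
  also have "\<dots> = Emin + ennreal (11 / 8)"
    by (simp flip: ennreal_plus ennreal_mult ennreal_numeral ennreal_1 add: add.assoc)
  finally have "ennreal (5 / 8) \<le> Emin"
    by (cases Emin) (auto simp: ennreal_plus[symmetric] simp del: ennreal_plus)
  then have "ennreal (5 / 8) * \<Delta> \<le> (\<integral>\<^sup>+p. ennreal (min (W1 p) (W2 p)) * \<Delta> \<partial>?R)"
    unfolding Emin_def by (subst nn_integral_multc) (auto intro: mult_right_mono)
  also have "\<dots> \<le> (\<integral>\<^sup>+p. F1 p * ennreal (W1 p) + F2 p * ennreal (W2 p) \<partial>?R)"
  proof (rule nn_integral_mono)
    fix p assume "p \<in> space ?R"
    then have "ennreal (min (W1 p) (W2 p)) * \<Delta> \<le> ennreal (min (W1 p) (W2 p)) * (F1 p + F2 p)"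
      by (intro mult_left_mono sep) auto
    also have "\<dots> = F1 p * ennreal (min (W1 p) (W2 p)) + F2 p * ennreal (min (W1 p) (W2 p))"
      by (simp add: algebra_simps)
    also have "\<dots> \<le> F1 p * ennreal (W1 p) + F2 p * ennreal (W2 p)"
      by (intro add_mono mult_left_mono ennreal_leI) auto
    finally show "ennreal (min (W1 p) (W2 p)) * \<Delta> \<le> F1 p * ennreal (W1 p) + F2 p * ennreal (W2 p)" .
  qed
  also have "\<dots> = (\<integral>\<^sup>+p. F1 p * ennreal (W1 p) \<partial>?R) + (\<integral>\<^sup>+p. F2 p * ennreal (W2 p) \<partial>?R)"
    by (intro nn_integral_add) measurable
  also have "(\<integral>\<^sup>+p. F1 p * ennreal (W1 p) \<partial>?R) =
      (\<integral>\<^sup>+p. F1 p \<partial>rounds C I (\<lambda>i. density (M i) (\<lambda>x. ennreal (l1 i x))) K)"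
    unfolding W1_def by (rule nn_integral_rounds_density[where M = M and l = l1, OF I M l1 F1 inv1, symmetric])
  also have "(\<integral>\<^sup>+p. F2 p * ennreal (W2 p) \<partial>?R) =
      (\<integral>\<^sup>+p. F2 p \<partial>rounds C I (\<lambda>i. density (M i) (\<lambda>x. ennreal (l2 i x))) K)"
    unfolding W2_def by (rule nn_integral_rounds_density[where M = M and l = l2, OF I M l2 F2 inv2, symmetric])
  finally show ?thesis .
qed

section \<open>Vectors on the first axis and biased coins\<close>

lemma space_Rn_borel [simp]: "space (Rn_borel n) = Rn n"
  by (simp add: Rn_borel_def Rn_def space_PiM)

lemma restrict_space_space: "restrict_space M (space M) = M"
  by (intro measure_eqI)
    (auto simp: sets_restrict_space emeasure_restrict_space Int_absorb1 sets.sets_into_space image_iff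
      intro!: bexI)

definition axis_vec :: "nat \<Rightarrow> real \<Rightarrow> rvec" where
  "axis_vec n a = (\<lambda>c\<in>{..<n}. if c = 0 then a else 0)"

lemma axis_vec_in_Rn [simp]: "axis_vec n a \<in> Rn n"
  by (simp add: axis_vec_def Rn_def)

lemma axis_vec_0 [simp]: "n \<ge> 1 \<Longrightarrow> axis_vec n a 0 = a"
  by (simp add: axis_vec_def)

lemma L2_set_axis:
  fixes n :: nat
  assumes "n \<ge> 1"
  shows "L2_set (\<lambda>c. if c = 0 then a else (0::real)) {..<n} = \<bar>a\<bar>"
proof -
  have "(\<Sum>c<n. (if c = 0 then a else 0)\<^sup>2) = (\<Sum>c<n. if c = 0 then a\<^sup>2 else 0)"
    by (intro sum.cong) auto
  then show ?thesis using assms by (simp add: L2_set_def sum.delta)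
qed

lemma dist_Rn_axis:
  assumes "n \<ge> 1" and "\<And>c. c < n \<Longrightarrow> x c - y c = (if c = 0 then a else 0)"
  shows "dist_Rn n x y = \<bar>a\<bar>"
  unfolding dist_Rn_def L2_set_axis[OF assms(1), symmetric] using assms(2)
  by (intro L2_set_cong) auto

lemma norm_Rn_axis:
  assumes "n \<ge> 1" and "\<And>c. c < n \<Longrightarrow> x c = (if c = 0 then a else 0)"
  shows "norm_Rn n x = \<bar>a\<bar>"
  unfolding norm_Rn_def L2_set_axis[OF assms(1), symmetric] using assms(2)
  by (intro L2_set_cong) auto

lemma dist_Rn_sq: "(dist_Rn n x y)\<^sup>2 = (\<Sum>c<n. (x c - y c)\<^sup>2)"
  by (simp add: dist_Rn_def L2_set_def sum_nonneg)

lemma dist_Rn_nonneg: "0 \<le> dist_Rn n x y"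
  by (simp add: dist_Rn_def)

lemma measurable_coord:
  "c < n \<Longrightarrow> (\<lambda>x. x c) \<in> borel_measurable (Rn_borel n)"
  unfolding Rn_borel_def by (rule measurable_component_singleton) simp

lemma measurable_axis_vec: "axis_vec n \<in> borel \<rightarrow>\<^sub>M Rn_borel n"
  unfolding axis_vec_def[abs_def] Rn_borel_def by (intro measurable_restrict) simp

text \<open>Samples are signed coins embedded in the first coordinate, with values \<open>s\<close> and \<open>- s\<close>. The bias is
  written as a density with respect to the fair coin, so that likelihood ratios are immediate. For
  \<open>s = 0\<close> the sign, and with it the bias, disappears: such a coin carries no information.\<close>

definition coin :: "nat \<Rightarrow> real \<Rightarrow> rvec measure" where
  "coin n s = distr (measure_pmf (pmf_of_set {- 1, 1})) (Rn_borel n) (\<lambda>z. axis_vec n (s * z))"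

definition bias_density :: "real \<Rightarrow> rvec \<Rightarrow> real" where
  "bias_density t \<xi> = 1 + t * sgn (\<xi> 0)"

definition biased_coin :: "nat \<Rightarrow> real \<Rightarrow> real \<Rightarrow> rvec measure" where
  "biased_coin n s t = density (coin n s) (\<lambda>\<xi>. ennreal (bias_density t \<xi>))"

lemma sets_coin [simp]: "sets (coin n s) = sets (Rn_borel n)"
  by (simp add: coin_def)

lemma sets_biased_coin [simp]: "sets (biased_coin n s t) = sets (Rn_borel n)"
  by (simp add: biased_coin_def)

lemma measurable_coin_map:
  "(\<lambda>z. axis_vec n (s * z)) \<in> measure_pmf p \<rightarrow>\<^sub>M Rn_borel n"
  by (rule measurable_compose[OF _ measurable_axis_vec]) simp

lemma prob_space_coin: "prob_space (coin n s)"
  unfolding coin_def by (intro measure_pmf.prob_space_distr measurable_coin_map)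

lemma bias_density_nonneg:
  assumes "\<bar>t\<bar> \<le> 1"
  shows "0 \<le> bias_density t \<xi>"
  using assms by (auto simp: bias_density_def sgn_real_def)

lemma bias_density_prod:
  shows "bias_density t \<xi> * bias_density (- t) \<xi> \<le> 1"
    and "1 - t\<^sup>2 \<le> bias_density t \<xi> * bias_density (- t) \<xi>"
  by (auto simp: bias_density_def sgn_real_def algebra_simps power2_eq_square)

lemma measurable_bias_density:
  assumes "n \<ge> 1"
  shows "bias_density t \<in> borel_measurable (Rn_borel n)"
proof -
  have [measurable]: "(\<lambda>\<xi>. \<xi> 0) \<in> borel_measurable (Rn_borel n)"
    using assms by (intro measurable_coord) simp
  show ?thesis unfolding bias_density_def[abs_def] by measurable
qed

lemma nn_integral_biased_coin:
  assumes n: "n \<ge> 1" and s: "0 \<le> s" and t: "\<bar>t\<bar> \<le> 1"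
    and f: "f \<in> borel_measurable (Rn_borel n)"
  shows "(\<integral>\<^sup>+\<xi>. f \<xi> \<partial>biased_coin n s t) =
    ennreal ((1 + t) / 2) * f (axis_vec n s) + ennreal ((1 - t) / 2) * f (axis_vec n (- s))"
proof -
  note [measurable] = f measurable_bias_density[OF n] measurable_coin_map
  have "(\<integral>\<^sup>+\<xi>. f \<xi> \<partial>biased_coin n s t) = (\<integral>\<^sup>+\<xi>. ennreal (bias_density t \<xi>) * f \<xi> \<partial>coin n s)"
    unfolding biased_coin_def by (intro nn_integral_density) (simp_all add: measurable_cong_sets[OF sets_coin refl])
  also have "\<dots> = (\<integral>\<^sup>+z. ennreal (bias_density t (axis_vec n (s * z))) * f (axis_vec n (s * z))
      \<partial>measure_pmf (pmf_of_set {- 1, 1}))"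
    unfolding coin_def by (intro nn_integral_distr) measurable
  also have "\<dots> = (ennreal (bias_density t (axis_vec n (- s))) * f (axis_vec n (- s)) +
      ennreal (bias_density t (axis_vec n s)) * f (axis_vec n s)) / 2"
    by (subst nn_integral_pmf_of_set) (simp_all add: add.commute)
  also have "\<dots> = ennreal ((1 + t) / 2) * f (axis_vec n s) + ennreal ((1 - t) / 2) * f (axis_vec n (- s))"
  proof -
    have half: "(ennreal a * y + ennreal b * z) / 2 = ennreal (a / 2) * y + ennreal (b / 2) * z"
      if "0 \<le> a" "0 \<le> b" for a b y z
    proof -
      have *: "ennreal c / 2 = ennreal (c / 2)" if "0 \<le> c" for c
        using that by (simp add: divide_ennreal flip: ennreal_numeral)
      show ?thesis
        unfolding *[OF that(1), symmetric] *[OF that(2), symmetric] divide_ennreal_def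
        by (simp add: algebra_simps)
    qed
    show ?thesis
    proof (cases "s = 0")
      case True
      have "ennreal (1 / 2) * y + ennreal (1 / 2) * y = ennreal ((1 + t) / 2) * y + ennreal ((1 - t) / 2) * y" for y
        unfolding distrib_right[symmetric] using t by (subst (1 2) ennreal_plus[symmetric]) (auto simp: field_simps)
      then show ?thesis using True n half[of 1 1] by (simp add: bias_density_def)
    next
      case False
      have "0 \<le> 1 - t" "0 \<le> 1 + t" using t by auto
      from half[OF this] False s n show ?thesis
        by (simp add: bias_density_def)
    qed
  qed
  finally show ?thesis .
qed

lemma prob_space_biased_coin:
  assumes "n \<ge> 1" "0 \<le> s" "\<bar>t\<bar> \<le> 1"
  shows "prob_space (biased_coin n s t)"
proof
  have "(\<integral>\<^sup>+\<xi>. 1 \<partial>biased_coin n s t) = ennreal ((1 + t) / 2) + ennreal ((1 - t) / 2)"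
    using nn_integral_biased_coin[OF assms, of "\<lambda>_. 1"] by simp
  also have "\<dots> = 1"
    using assms(3) by (subst ennreal_plus[symmetric]) (auto simp: field_simps)
  finally show "emeasure (biased_coin n s t) (space (biased_coin n s t)) = 1" by simp
qed

lemma integral_biased_coin:
  fixes f :: "rvec \<Rightarrow> real"
  assumes n: "n \<ge> 1" and s: "0 \<le> s" and t: "\<bar>t\<bar> \<le> 1"
    and f: "f \<in> borel_measurable (Rn_borel n)"
  shows "integrable (biased_coin n s t) f"
    and "(\<integral>\<xi>. f \<xi> \<partial>biased_coin n s t) =
      (1 + t) / 2 * f (axis_vec n s) + (1 - t) / 2 * f (axis_vec n (- s))"
proof -
  note [measurable] = f measurable_bias_density[OF n] measurable_coin_map
  have f': "f \<in> borel_measurable (coin n s)" "bias_density t \<in> borel_measurable (coin n s)"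
    by (simp_all add: measurable_cong_sets[OF sets_coin refl])
  let ?g = "\<lambda>\<xi>. bias_density t \<xi> *\<^sub>R f \<xi>"
  have g: "?g \<in> borel_measurable (Rn_borel n)" by measurable
  have "integrable (coin n s) ?g"
    unfolding coin_def using g
    by (subst integrable_distr_eq[OF measurable_coin_map g]) (auto intro!: integrable_measure_pmf_finite)
  then show "integrable (biased_coin n s t) f"
    unfolding biased_coin_def using f' bias_density_nonneg[OF t]
    by (subst integrable_density) auto
  have "(\<integral>\<xi>. f \<xi> \<partial>biased_coin n s t) = (\<integral>\<xi>. ?g \<xi> \<partial>coin n s)"
    unfolding biased_coin_def using f' bias_density_nonneg[OF t] by (intro integral_density) auto
  also have "\<dots> = (\<integral>z. ?g (axis_vec n (s * z)) \<partial>measure_pmf (pmf_of_set {- 1, 1}))"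
    unfolding coin_def by (intro integral_distr measurable_coin_map g)
  also have "\<dots> = (?g (axis_vec n (- s)) + ?g (axis_vec n s)) / 2"
    by (subst integral_pmf_of_set) (simp_all add: add.commute)
  also have "\<dots> = (1 + t) / 2 * f (axis_vec n s) + (1 - t) / 2 * f (axis_vec n (- s))"
    using n s by (cases "s = 0") (simp_all add: bias_density_def field_simps)
  finally show "(\<integral>\<xi>. f \<xi> \<partial>biased_coin n s t) = \<dots>" .
qed

lemma nn_integral_biased_coin_coord:
  assumes n: "n \<ge> 1" and s: "0 \<le> s" and t: "\<bar>t\<bar> \<le> 1"
    and f: "f \<in> borel_measurable borel" "\<And>z. 0 \<le> f z"
  shows "(\<integral>\<^sup>+\<xi>. ennreal (f (\<xi> 0)) \<partial>biased_coin n s t) =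
    ennreal ((1 + t) / 2 * f s + (1 - t) / 2 * f (- s))"
proof -
  have "(\<lambda>\<xi>. ennreal (f (\<xi> 0))) \<in> borel_measurable (Rn_borel n)"
    by (rule measurable_compose[OF measurable_coord]) (use n f in simp_all)
  from nn_integral_biased_coin[OF n s t this] show ?thesis
    using n t f(2) by (simp add: ennreal_plus ennreal_mult'' flip: ennreal_mult)
qed

section \<open>Random linear perturbations of a convex function\<close>

lemma convex_Rn_of_subgradients:
  assumes "\<And>x. x \<in> Rn n \<Longrightarrow> has_subgradient n f x (g x)"
  shows "convex_Rn n f"
  unfolding convex_Rn_def
proof (intro ballI)
  fix x y :: rvec and t :: real
  assume x: "x \<in> Rn n" and y: "y \<in> Rn n" and t: "t \<in> {0..1}"
  define z where "z = (\<lambda>c\<in>{..<n}. (1 - t) * x c + t * y c)"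
  have z: "z \<in> Rn n" by (simp add: z_def Rn_def)
  have "f z + (\<Sum>c<n. g z c * (x c - z c)) \<le> f x" (is "_ + ?X \<le> _")
    and "f z + (\<Sum>c<n. g z c * (y c - z c)) \<le> f y" (is "_ + ?Y \<le> _")
    using assms[OF z] x y by (auto simp: has_subgradient_def)
  then have "(1 - t) * (f z + ?X) + t * (f z + ?Y) \<le> (1 - t) * f x + t * f y"
    using t by (intro add_mono mult_left_mono) auto
  moreover have "(1 - t) * (f z + ?X) + t * (f z + ?Y) = f z + ((1 - t) * ?X + t * ?Y)"
    by (simp only: algebra_simps)
  moreover have "(1 - t) * ?X + t * ?Y = 0"
    unfolding sum_distrib_left sum.distrib[symmetric]
    by (rule sum.neutral) (auto simp: z_def algebra_simps)
  ultimately show "f (\<lambda>c\<in>{..<n}. (1 - t) * x c + t * y c) \<le> (1 - t) * f x + t * f y"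
    unfolding z_def[symmetric] by linarith
qed

text \<open>All hard instances perturb a deterministic function \<open>h\<close> by a random linear term in the first
  coordinate. Only the sample laws depend on the agent: agent \<open>j\<close> minimizes
  \<open>h x - s j * t j * x 0\<close>.\<close>

definition coin_problem :: "nat \<Rightarrow> nat \<Rightarrow> (rvec \<Rightarrow> real) \<Rightarrow> (rvec \<Rightarrow> rvec) \<Rightarrow> (nat \<Rightarrow> real) \<Rightarrow> (nat \<Rightarrow> real) \<Rightarrow> problem" where
  "coin_problem d D h g s t = \<lparr>sample_set = Rn D, sample_dist = (\<lambda>j. biased_coin D (s j) (t j)),
     loss = (\<lambda>x \<xi>. h x - \<xi> 0 * x 0),
     sgrad = (\<lambda>x \<xi>. \<lambda>c\<in>{..<d}. g x c - (if c = 0 then \<xi> 0 else 0))\<rparr>"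

lemma coin_problem_sel [simp]:
  "sample_set (coin_problem d D h g s t) = Rn D"
  "sample_dist (coin_problem d D h g s t) = (\<lambda>j. biased_coin D (s j) (t j))"
  "loss (coin_problem d D h g s t) = (\<lambda>x \<xi>. h x - \<xi> 0 * x 0)"
  "sgrad (coin_problem d D h g s t) = (\<lambda>x \<xi>. \<lambda>c\<in>{..<d}. g x c - (if c = 0 then \<xi> 0 else 0))"
  by (simp_all add: coin_problem_def)

lemma has_subgradient_tilt:
  assumes "has_subgradient d h x v" and "d \<ge> 1"
  shows "has_subgradient d (\<lambda>y. h y - a * y 0) x (\<lambda>c\<in>{..<d}. v c - (if c = 0 then a else 0))"
  unfolding has_subgradient_def
proof
  fix y assume y: "y \<in> Rn d"
  have "(\<Sum>c<d. (\<lambda>c\<in>{..<d}. v c - (if c = 0 then a else 0)) c * (y c - x c)) =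
      (\<Sum>c<d. v c * (y c - x c) - (if c = 0 then a * (y 0 - x 0) else 0))"
    by (intro sum.cong) (auto simp: algebra_simps)
  also have "\<dots> = (\<Sum>c<d. v c * (y c - x c)) - a * (y 0 - x 0)"
    using assms(2) by (simp add: sum_subtractf)
  also have "\<dots> = (\<Sum>c<d. v c * (y c - x c)) - (a * y 0 - a * x 0)"
    by (simp only: right_diff_distrib)
  finally show "h x - a * x 0 + (\<Sum>c<d. (\<lambda>c\<in>{..<d}. v c - (if c = 0 then a else 0)) c * (y c - x c))
      \<le> h y - a * y 0"
    using assms(1) y unfolding has_subgradient_def by fastforce
qed

context
  fixes d D :: nat and h :: "rvec \<Rightarrow> real" and g :: "rvec \<Rightarrow> rvec" and s t :: "nat \<Rightarrow> real"
  assumes d: "d \<ge> 1" and D: "D \<ge> 1" and s: "\<And>j. 0 \<le> s j" and t: "\<And>j. \<bar>t j\<bar> \<le> 1"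
begin

lemma objective_coin_problem:
  "objective (coin_problem d D h g s t) j x = h x - s j * t j * x 0"
proof -
  have "(\<lambda>\<xi>. h x - \<xi> 0 * x 0) \<in> borel_measurable (Rn_borel D)"
    using D by (intro borel_measurable_diff borel_measurable_times borel_measurable_const measurable_coord) simp
  then show ?thesis
    using D by (simp add: objective_def integral_biased_coin[OF D s t]) (simp add: field_simps)
qed

lemma coord_part_measurable: "(\<lambda>\<xi>. a - (if P then \<xi> 0 else 0)) \<in> borel_measurable (Rn_borel D)"
proof -
  have [measurable]: "(\<lambda>\<xi>. \<xi> 0) \<in> borel_measurable (Rn_borel D)"
    using D by (intro measurable_coord) simp
  show ?thesis by measurable
qed

lemma mean_grad_coin_problem:
  "mean_grad d (coin_problem d D h g s t) j x = (\<lambda>c\<in>{..<d}. g x c - (if c = 0 then s j * t j else 0))"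
  unfolding mean_grad_def
  using D by (intro restrict_ext) (simp add: integral_biased_coin[OF D s t coord_part_measurable], simp add: field_simps)

lemma well_posed_coin_problem:
  assumes h: "h \<in> borel_measurable (Rn_borel d)" and g: "g \<in> Rn_borel d \<rightarrow>\<^sub>M Rn_borel d"
    and sub: "\<And>x. x \<in> Rn d \<Longrightarrow> has_subgradient d h x (g x)"
  shows "well_posed N d D (coin_problem d D h g s t)"
proof -
  have restrict: "restrict_space (Rn_borel D) (Rn D) = Rn_borel D"
    using restrict_space_space[of "Rn_borel D"] by simp
  have [measurable]: "(\<lambda>x. x 0) \<in> borel_measurable (Rn_borel d)" "(\<lambda>x. x 0) \<in> borel_measurable (Rn_borel D)"
    using d D by (auto intro: measurable_coord)
  note [measurable] = h
  have loss: "(\<lambda>(x, \<xi>). h x - \<xi> 0 * x 0) \<in> borel_measurable (Rn_borel d \<Otimes>\<^sub>M Rn_borel D)"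
    unfolding case_prod_unfold by measurable
  have sgrad: "(\<lambda>(x, \<xi>). \<lambda>c\<in>{..<d}. g x c - (if c = 0 then \<xi> 0 else 0)) \<in> Rn_borel d \<Otimes>\<^sub>M Rn_borel D \<rightarrow>\<^sub>M Rn_borel d"
    unfolding case_prod_unfold Rn_borel_def[of d]
  proof (rule measurable_restrict)
    fix c assume "c \<in> {..<d}"
    then have [measurable]: "(\<lambda>x. g x c) \<in> borel_measurable (Rn_borel d)"
      by (intro measurable_compose[OF g] measurable_coord) simp
    have "(\<lambda>p. g (fst p) c - (if c = 0 then snd p 0 else 0)) \<in> borel_measurable (Rn_borel d \<Otimes>\<^sub>M Rn_borel D)"
      by measurable
    then show "(\<lambda>p. g (fst p) c - (if c = 0 then snd p 0 else 0))
        \<in> borel_measurable ((\<Pi>\<^sub>M c\<in>{..<d}. borel) \<Otimes>\<^sub>M Rn_borel D)"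
      by (simp add: Rn_borel_def)
  qed
  show ?thesis
    unfolding well_posed_def
  proof (intro conjI ballI)
    fix j x assume x: "x \<in> Rn d"
    show "has_subgradient d (objective (coin_problem d D h g s t) j) x (mean_grad d (coin_problem d D h g s t) j x)"
      unfolding mean_grad_coin_problem objective_coin_problem[abs_def]
      by (rule has_subgradient_tilt[OF sub[OF x] d])
    show "integrable (sample_dist (coin_problem d D h g s t) j) (loss (coin_problem d D h g s t) x)"
      by (simp add: integral_biased_coin[OF D s t])
    show "\<forall>c<d. integrable (sample_dist (coin_problem d D h g s t) j) (\<lambda>\<xi>. sgrad (coin_problem d D h g s t) x \<xi> c)"
      by (simp add: integral_biased_coin[OF D s t coord_part_measurable])
    fix \<xi>
    have "has_subgradient d (\<lambda>y. loss (coin_problem d D h g s t) y \<xi>) x (sgrad (coin_problem d D h g s t) x \<xi>)"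
      using has_subgradient_tilt[OF sub[OF x] d, of "\<xi> 0"] by simp
    then show "has_gradient d (\<lambda>y. loss (coin_problem d D h g s t) y \<xi>) x (sgrad (coin_problem d D h g s t) x \<xi>) \<or>
        has_subgradient d (\<lambda>y. loss (coin_problem d D h g s t) y \<xi>) x (sgrad (coin_problem d D h g s t) x \<xi>)" ..
  qed (use loss sgrad in \<open>simp_all add: restrict prob_space_biased_coin[OF D s t]\<close>)
qed

end

section \<open>The two-point bound for learning algorithms\<close>

text \<open>The transcript depends on the samples only through those of the agents drawn; this is what makes
  the revealed likelihood ratio the relevant one.\<close>

lemma history_cong:
  assumes "\<And>k. k < K \<Longrightarrow> fst (p k) = fst (q k)"
    and "\<And>k i. k < K \<Longrightarrow> i \<in> {1..N} \<Longrightarrow> i \<in> fst (p k) \<Longrightarrow> snd (p k) i = snd (q k) i"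
  shows "history N d D P A u p K = history N d D P A u q K"
  using assms
proof (induction K)
  case (Suc K)
  then have IH: "history N d D P A u p K = history N d D P A u q K" by simp
  have "oracle_answer N d D P (fst (p K)) x (snd (p K)) = oracle_answer N d D P (fst (q K)) x (snd (q K))" for x
    unfolding oracle_answer_def
    using Suc.prems(1)[of K] Suc.prems(2)[of K] by (intro restrict_ext) simp
  then show ?case by (simp add: IH)
qed simp

text \<open>Two problems with the same loss and gradients produce the same transcript from the same samples.
  Hence the two hypotheses differ only in the measure, and a single function describes the algorithm.\<close>

lemma history_problem_cong:
  assumes "loss P = loss P'" "sgrad P = sgrad P'"
  shows "history N d D P A u p K = history N d D P' A u p K"
proof (induction K)
  case (Suc K)
  have "oracle_answer N d D P = oracle_answer N d D P'"
    unfolding oracle_answer_def[abs_def] assms ..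
  then show ?case by (simp add: Suc)
qed simp

lemma measurable_oracle_answer:
  assumes wp: "well_posed N d D P"
    and S: "S \<in> M \<rightarrow>\<^sub>M measure_pmf C"
    and x: "x \<in> M \<rightarrow>\<^sub>M (\<Pi>\<^sub>M i\<in>{1..N}. Rn_borel d)"
    and \<xi>: "\<xi> \<in> M \<rightarrow>\<^sub>M PiM {1..N} (sample_dist P)"
  shows "(\<lambda>a. oracle_answer N d D P (S a) (x a) (\<xi> a)) \<in> M \<rightarrow>\<^sub>M answer_space N d D"
  unfolding oracle_answer_def answer_space_def
proof (rule measurable_restrict)
  fix i assume i: "i \<in> {1..N}"
  define Q where "Q = restrict_space (Rn_borel D) (sample_set P)"
  have [measurable]: "(\<lambda>(x, \<xi>). loss P x \<xi>) \<in> borel_measurable (Rn_borel d \<Otimes>\<^sub>M Q)"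
    "(\<lambda>(x, \<xi>). sgrad P x \<xi>) \<in> Rn_borel d \<Otimes>\<^sub>M Q \<rightarrow>\<^sub>M Rn_borel d"
    using wp by (auto simp: well_posed_def Q_def)
  have sets: "sets (sample_dist P i) = sets Q"
    using wp i by (auto simp: well_posed_def Q_def)
  have [measurable]: "(\<lambda>a. x a i) \<in> M \<rightarrow>\<^sub>M Rn_borel d"
    by (rule measurable_compose[OF x]) (use i in \<open>rule measurable_component_singleton\<close>)
  have "(\<lambda>a. \<xi> a i) \<in> M \<rightarrow>\<^sub>M sample_dist P i"
    by (rule measurable_compose[OF \<xi>]) (use i in \<open>rule measurable_component_singleton\<close>)
  then have xiQ[measurable]: "(\<lambda>a. \<xi> a i) \<in> M \<rightarrow>\<^sub>M Q"
    using sets by (simp cong: measurable_cong_sets)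
  have [measurable]: "(\<lambda>a. \<xi> a i) \<in> M \<rightarrow>\<^sub>M Rn_borel D"
    by (rule measurable_compose[OF xiQ]) (auto simp: Q_def intro!: measurable_restrict_space1)
  have [measurable]: "Measurable.pred M (\<lambda>a. i \<in> S a)"
    by (rule measurable_compose[OF S]) simp
  have zero: "zero_vec n \<in> space (Rn_borel n)" for n
    by (auto simp: zero_vec_def Rn_def)
  have l: "(\<lambda>a. loss P (x a i) (\<xi> a i)) \<in> borel_measurable M"
    "(\<lambda>a. sgrad P (x a i) (\<xi> a i)) \<in> M \<rightarrow>\<^sub>M Rn_borel d"
    by measurable
  show "(\<lambda>a. if i \<in> S a then (True, x a i, \<xi> a i, loss P (x a i) (\<xi> a i), sgrad P (x a i) (\<xi> a i))
      else (False, zero_vec d, zero_vec D, 0, zero_vec d))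
      \<in> M \<rightarrow>\<^sub>M count_space UNIV \<Otimes>\<^sub>M Rn_borel d \<Otimes>\<^sub>M Rn_borel D \<Otimes>\<^sub>M borel \<Otimes>\<^sub>M Rn_borel d"
    using l by (intro measurable_If measurable_Pair measurable_const zero) simp_all
qed

lemma measurable_history:
  assumes wp: "well_posed N d D P" and A: "valid_algorithm N d D K A" and "k \<le> K"
  shows "(\<lambda>(u, p). history N d D P A u p k)
    \<in> borel \<Otimes>\<^sub>M rounds C {1..N} (sample_dist P) K \<rightarrow>\<^sub>M (\<Pi>\<^sub>M l\<in>{..<k}. answer_space N d D)"
  using \<open>k \<le> K\<close>
proof (induction k)
  case 0
  show ?case by (simp add: PiM_empty)
next
  case (Suc k)
  let ?M = "borel \<Otimes>\<^sub>M rounds C {1..N} (sample_dist P) K"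
  have k: "k < K" using Suc.prems by simp
  have hist: "(\<lambda>(u, p). history N d D P A u p k) \<in> ?M \<rightarrow>\<^sub>M (\<Pi>\<^sub>M l\<in>{..<k}. answer_space N d D)"
    using Suc by simp
  have q: "query A k \<in> borel \<Otimes>\<^sub>M (\<Pi>\<^sub>M l\<in>{..<k}. answer_space N d D) \<rightarrow>\<^sub>M (\<Pi>\<^sub>M i\<in>{1..N}. Rn_borel d)"
    using A k by (auto simp: valid_algorithm_def)
  have pair: "(\<lambda>a. (fst a, case a of (u, p) \<Rightarrow> history N d D P A u p k))
      \<in> ?M \<rightarrow>\<^sub>M borel \<Otimes>\<^sub>M (\<Pi>\<^sub>M l\<in>{..<k}. answer_space N d D)"
    using hist by (intro measurable_Pair) simp_all
  have comp: "(\<lambda>a. snd a k) \<in> ?M \<rightarrow>\<^sub>M (measure_pmf C \<Otimes>\<^sub>M PiM {1..N} (sample_dist P))"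
    by (rule measurable_compose[OF measurable_snd])
      (use k in \<open>auto simp: rounds_def intro!: measurable_component_singleton\<close>)
  have "(\<lambda>a. oracle_answer N d D P (fst (snd a k))
        (query A k (fst a, case a of (u, p) \<Rightarrow> history N d D P A u p k)) (snd (snd a k)))
      \<in> ?M \<rightarrow>\<^sub>M answer_space N d D"
    by (rule measurable_oracle_answer[OF wp measurable_compose[OF comp measurable_fst]
          measurable_compose[OF pair q] measurable_compose[OF comp measurable_snd]])
  with hist have "(\<lambda>a. (case a of (u, p) \<Rightarrow> history N d D P A u p k)
        (k := oracle_answer N d D P (fst (snd a k))
          (query A k (fst a, case a of (u, p) \<Rightarrow> history N d D P A u p k)) (snd (snd a k))))
      \<in> ?M \<rightarrow>\<^sub>M (\<Pi>\<^sub>M l\<in>{..<Suc k}. answer_space N d D)"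
    by (intro measurable_fun_upd[where J = "{..<k}"]) auto
  then show ?case by (simp only: history.simps case_prod_unfold)
qed

lemma measurable_objective:
  assumes wp: "well_posed N d D P" and i: "i \<in> {1..N}"
  shows "objective P i \<in> borel_measurable (Rn_borel d)"
proof -
  have sets[measurable_cong]: "sets (sample_dist P i) = sets (restrict_space (Rn_borel D) (sample_set P))"
    and ps: "prob_space (sample_dist P i)"
    and loss: "(\<lambda>(x, \<xi>). loss P x \<xi>) \<in> borel_measurable (Rn_borel d \<Otimes>\<^sub>M restrict_space (Rn_borel D) (sample_set P))"
    using wp i by (auto simp: well_posed_def)
  interpret prob_space "sample_dist P i" by fact
  have "sets (Rn_borel d \<Otimes>\<^sub>M sample_dist P i) = sets (Rn_borel d \<Otimes>\<^sub>M restrict_space (Rn_borel D) (sample_set P))"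
    by (intro sets_pair_measure_cong sets refl)
  then have "(\<lambda>(x, \<xi>). loss P x \<xi>) \<in> borel_measurable (Rn_borel d \<Otimes>\<^sub>M sample_dist P i)"
    using loss by (simp cong: measurable_cong_sets)
  then show ?thesis
    unfolding objective_def[abs_def] by (rule borel_measurable_lebesgue_integral)
qed

text \<open>In both oracle models a budget of \<open>T\<close> samples draws each agent \<open>T / N\<close> times in the mean.\<close>

lemma expected_agents_drawn:
  assumes N: "N \<ge> 1" and v: "\<And>i. 0 \<le> v i"
  shows "of_nat K * (\<integral>\<^sup>+S. ennreal (\<Sum>i\<in>{1..N}. if i \<in> S then v i else 0) \<partial>measure_pmf (agent_choice orc N))
    = ennreal (real (samples_used orc N K) / real N * (\<Sum>i\<in>{1..N}. v i))"
proof (cases orc)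
  case Synchronous
  have "(\<Sum>i\<in>{1..N}. if i \<in> {1..N} then v i else 0) = (\<Sum>i\<in>{1..N}. v i)"
    by (intro sum.cong) auto
  with Synchronous N v show ?thesis
    by (simp add: agent_choice_def samples_used_def ennreal_of_nat_eq_real_of_nat sum_nonneg flip: ennreal_mult)
next
  case Asynchronous
  have "(\<Sum>i\<in>{1..N}. if i \<in> {j} then v i else 0) = (if j \<in> {1..N} then v j else 0)" for j
    by (simp add: sum.delta)
  then have "(\<integral>\<^sup>+S. ennreal (\<Sum>i\<in>{1..N}. if i \<in> S then v i else 0) \<partial>measure_pmf (agent_choice orc N))
      = (\<integral>\<^sup>+j. ennreal (if j \<in> {1..N} then v j else 0) \<partial>measure_pmf (pmf_of_set {1..N}))"
    using Asynchronous by (simp add: agent_choice_def)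
  also have "\<dots> = (\<Sum>j\<in>{1..N}. ennreal (if j \<in> {1..N} then v j else 0)) / ennreal (real N)"
    using N by (subst nn_integral_pmf_of_set) (auto simp: ennreal_of_nat_eq_real_of_nat)
  also have "(\<Sum>j\<in>{1..N}. ennreal (if j \<in> {1..N} then v j else 0)) = ennreal (\<Sum>j\<in>{1..N}. v j)"
    using v by (simp add: sum_ennreal)
  finally show ?thesis
    using Asynchronous N v
    by (simp add: samples_used_def ennreal_of_nat_eq_real_of_nat sum_nonneg divide_ennreal flip: ennreal_mult)
qed

text \<open>The two-point argument for an arbitrary algorithm: conditionally on the seed, the returned point is
  a function of the rounds, to which the abstract bound applies; then the seed is integrated out.
  \<open>Q\<close> is a common reference law for the samples, and \<open>v j\<close> bounds how much one sample of agent \<open>j\<close>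
  helps to tell the two problems apart.\<close>

lemma expected_gap_sum_ge:
  assumes wp: "well_posed N d D P1" "well_posed N d D P2" and A: "valid_algorithm N d D K A"
    and N: "N \<ge> 1" and i: "i \<in> {1..N}"
    and same: "loss P1 = loss P2" "sgrad P1 = sgrad P2"
    and Q: "\<And>j. prob_space (Q j)"
    and l1: "\<And>j. l1 j \<in> borel_measurable (Q j)" "\<And>j x. 0 \<le> l1 j x"
      "\<And>j. prob_space (density (Q j) (\<lambda>x. ennreal (l1 j x)))"
    and l2: "\<And>j. l2 j \<in> borel_measurable (Q j)" "\<And>j x. 0 \<le> l2 j x"
      "\<And>j. prob_space (density (Q j) (\<lambda>x. ennreal (l2 j x)))"
    and dist: "sample_dist P1 = (\<lambda>j. density (Q j) (\<lambda>x. ennreal (l1 j x)))"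
      "sample_dist P2 = (\<lambda>j. density (Q j) (\<lambda>x. ennreal (l2 j x)))"
    and v: "\<And>j. 0 \<le> v j" "\<And>j x. l1 j x * l2 j x \<le> 1" "\<And>j x. 1 - v j \<le> l1 j x * l2 j x"
    and budget: "real (samples_used orc N K) / real N * (\<Sum>j\<in>{1..N}. v j) \<le> 1 / 16"
    and sep: "\<And>x. x \<in> Rn d \<Longrightarrow> \<Delta> \<le> (objective P1 i x - (INF y\<in>Rn d. objective P1 i y)) +
      (objective P2 i x - (INF y\<in>Rn d. objective P2 i y))"
  shows "ennreal (5 / 8 * \<Delta>) \<le> expected_gap orc N d D K A P1 i + expected_gap orc N d D K A P2 i"
proof -
  let ?C = "agent_choice orc N"
  let ?I = "{1..N}"
  let ?R = "\<lambda>M. rounds ?C ?I M K"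
  interpret U: prob_space "seed A" using A by (simp add: valid_algorithm_def)
  have Useeds: "sets (seed A) = sets borel" using A by (simp add: valid_algorithm_def)
  define ret where "ret u p = returned A (u, history N d D P1 A u p K) i" for u p
  define F where "F P u p = ennreal (objective P i (ret u p) - (INF y\<in>Rn d. objective P i y))" for P u p
  have R: "prob_space (?R (sample_dist P1))" "prob_space (?R (sample_dist P2))"
    unfolding dist by (rule prob_space_rounds, rule l1 l2)+
  have sets_R: "sets (?R (sample_dist P1)) = sets (?R Q)" "sets (?R (sample_dist P2)) = sets (?R Q)"
    unfolding dist rounds_def by (intro sets_PiM_cong sets_pair_measure_cong refl; simp)+
  have meas_ret: "(\<lambda>(u, p). ret u p) \<in> borel \<Otimes>\<^sub>M ?R (sample_dist P1) \<rightarrow>\<^sub>M Rn_borel d"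
  proof -
    have pair: "(\<lambda>a. (fst a, case a of (u, p) \<Rightarrow> history N d D P1 A u p K))
        \<in> borel \<Otimes>\<^sub>M ?R (sample_dist P1) \<rightarrow>\<^sub>M borel \<Otimes>\<^sub>M (\<Pi>\<^sub>M l\<in>{..<K}. answer_space N d D)"
      using measurable_history[OF wp(1) A order_refl] by (intro measurable_Pair) simp_all
    have "returned A \<in> borel \<Otimes>\<^sub>M (\<Pi>\<^sub>M l\<in>{..<K}. answer_space N d D) \<rightarrow>\<^sub>M (\<Pi>\<^sub>M i\<in>{1..N}. Rn_borel d)"
      using A by (simp add: valid_algorithm_def)
    from measurable_compose[OF measurable_compose[OF pair this] measurable_component_singleton[OF i]]
    have "(\<lambda>a. returned A (fst a, case a of (u, p) \<Rightarrow> history N d D P1 A u p K) i)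
        \<in> borel \<Otimes>\<^sub>M ?R (sample_dist P1) \<rightarrow>\<^sub>M Rn_borel d" .
    then show ?thesis by (simp add: ret_def case_prod_unfold)
  qed
  have meas_F: "(\<lambda>(u, p). F P u p) \<in> borel_measurable (seed A \<Otimes>\<^sub>M ?R Q)" if "well_posed N d D P" for P
  proof -
    have "sets (seed A \<Otimes>\<^sub>M ?R Q) = sets (borel \<Otimes>\<^sub>M ?R (sample_dist P1))"
      by (intro sets_pair_measure_cong Useeds sets_R[symmetric])
    then have "(\<lambda>(u, p). ret u p) \<in> seed A \<Otimes>\<^sub>M ?R Q \<rightarrow>\<^sub>M Rn_borel d"
      using meas_ret by (simp cong: measurable_cong_sets)
    from measurable_compose[OF this measurable_objective[OF that i]]
    have [measurable]: "(\<lambda>(u, p). objective P i (ret u p)) \<in> borel_measurable (seed A \<Otimes>\<^sub>M ?R Q)"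
      by (simp add: case_prod_unfold)
    show ?thesis unfolding F_def case_prod_unfold by measurable
  qed
  have R_P: "prob_space (?R (sample_dist P))" and meas_FP: "(\<lambda>(u, p). F P u p) \<in> borel_measurable (seed A \<Otimes>\<^sub>M ?R (sample_dist P))"
    if P: "P = P1 \<or> P = P2" for P
  proof -
    show "prob_space (?R (sample_dist P))" using P R by (elim disjE) simp_all
    have sets: "sets (?R (sample_dist P)) = sets (?R Q)" using P sets_R by (elim disjE) simp_all
    have "well_posed N d D P" using P wp by (elim disjE) simp_all
    note meas_F[OF this]
    also have "borel_measurable (seed A \<Otimes>\<^sub>M ?R Q) = borel_measurable (seed A \<Otimes>\<^sub>M ?R (sample_dist P))"
      by (intro measurable_cong_sets sets_pair_measure_cong sets[symmetric] refl)
    finally show "(\<lambda>(u, p). F P u p) \<in> borel_measurable (seed A \<Otimes>\<^sub>M ?R (sample_dist P))" .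
  qed
  have gap: "expected_gap orc N d D K A P i = (\<integral>\<^sup>+u. (\<integral>\<^sup>+p. F P u p \<partial>?R (sample_dist P)) \<partial>seed A)"
    if P: "P = P1 \<or> P = P2" for P
  proof -
    have eq: "loss P = loss P1" "sgrad P = sgrad P1" using P same by (elim disjE; simp)+
    note hist = history_problem_cong[OF eq]
    interpret RP: prob_space "?R (sample_dist P)" by (rule R_P[OF P])
    have "expected_gap orc N d D K A P i = (\<integral>\<^sup>+(u, p). F P u p \<partial>(seed A \<Otimes>\<^sub>M ?R (sample_dist P)))"
      unfolding expected_gap_def run_space_def F_def ret_def rounds_def hist ..
    also have "\<dots> = (\<integral>\<^sup>+u. (\<integral>\<^sup>+p. F P u p \<partial>?R (sample_dist P)) \<partial>seed A)"
      using RP.nn_integral_fst[OF meas_FP[OF P]] by simp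
    finally show ?thesis .
  qed
  have inv: "F P u p = F P u q"
    if "\<And>k. k < K \<Longrightarrow> fst (p k) = fst (q k)"
      "\<And>k j. k < K \<Longrightarrow> j \<in> ?I \<Longrightarrow> j \<in> fst (p k) \<Longrightarrow> snd (p k) j = snd (q k) j" for P u p q
    unfolding F_def ret_def using history_cong[OF that] by simp
  have ret_Rn: "ret u p \<in> Rn d" if "p \<in> space (?R Q)" for u p
    using measurable_space[OF meas_ret, of "(u, p)"] that sets_eq_imp_space_eq[OF sets_R(1)]
    by (simp add: space_pair_measure)
  have pointwise: "ennreal (5 / 8) * ennreal \<Delta> \<le>
      (\<integral>\<^sup>+p. F P1 u p \<partial>?R (sample_dist P1)) + (\<integral>\<^sup>+p. F P2 u p \<partial>?R (sample_dist P2))"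
    if u: "u \<in> space (seed A)" for u
    unfolding dist
  proof (rule two_point_rounds[where v = v, OF _ Q l1 l2 v])
    show "finite ?I" by simp
    show "F P1 u p = F P1 u q" "F P2 u p = F P2 u q"
      if "\<And>k. k < K \<Longrightarrow> fst (p k) = fst (q k)"
        "\<And>k j. k < K \<Longrightarrow> j \<in> ?I \<Longrightarrow> j \<in> fst (p k) \<Longrightarrow> snd (p k) j = snd (q k) j" for p q
      by (rule inv[OF that]; assumption)+
    show "of_nat K * (\<integral>\<^sup>+S. ennreal (\<Sum>j\<in>?I. if j \<in> S then v j else 0) \<partial>measure_pmf ?C) \<le> ennreal (1 / 16)"
      using expected_agents_drawn[OF N v(1)] budget by (simp add: ennreal_leI)
    show "ennreal \<Delta> \<le> F P1 u p + F P2 u p" if "p \<in> space (?R Q)" for p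
    proof -
      have "\<Delta> \<le> max 0 (objective P1 i (ret u p) - (INF y\<in>Rn d. objective P1 i y)) +
          max 0 (objective P2 i (ret u p) - (INF y\<in>Rn d. objective P2 i y))"
        using sep[OF ret_Rn[OF that, of u]] by linarith
      then have "ennreal \<Delta> \<le> ennreal (max 0 (objective P1 i (ret u p) - (INF y\<in>Rn d. objective P1 i y)) +
          max 0 (objective P2 i (ret u p) - (INF y\<in>Rn d. objective P2 i y)))"
        by (rule ennreal_leI)
      also have "\<dots> = F P1 u p + F P2 u p"
        by (simp add: F_def ennreal_plus max_def ennreal_neg)
      finally show ?thesis .
    qed
    show "F P1 u \<in> borel_measurable (?R Q)" "F P2 u \<in> borel_measurable (?R Q)"
      using measurable_Pair2[OF meas_F u] wp by auto
  qed
  have meas_inner: "(\<lambda>u. \<integral>\<^sup>+p. F P u p \<partial>?R (sample_dist P)) \<in> borel_measurable (seed A)"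
    if P: "P = P1 \<or> P = P2" for P
  proof -
    interpret RP: prob_space "?R (sample_dist P)" by (rule R_P[OF P])
    from RP.borel_measurable_nn_integral_fst[OF meas_FP[OF P]] show ?thesis by simp
  qed
  have "ennreal (5 / 8 * \<Delta>) = (\<integral>\<^sup>+u. ennreal (5 / 8) * ennreal \<Delta> \<partial>seed A)"
    by (simp only: ennreal_mult'[of "5 / 8"] nn_integral_const U.emeasure_space_1) simp
  also have "\<dots> \<le> (\<integral>\<^sup>+u. (\<integral>\<^sup>+p. F P1 u p \<partial>?R (sample_dist P1)) + (\<integral>\<^sup>+p. F P2 u p \<partial>?R (sample_dist P2)) \<partial>seed A)"
    by (intro nn_integral_mono pointwise)
  also have "\<dots> = expected_gap orc N d D K A P1 i + expected_gap orc N d D K A P2 i"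
    unfolding gap[OF disjI1[OF refl]] gap[OF disjI2[OF refl]]
    by (rule nn_integral_add[OF meas_inner[OF disjI1[OF refl]] meas_inner[OF disjI2[OF refl]]])
  finally show ?thesis .
qed

section \<open>From error bounds to sample complexity\<close>

text \<open>If the two errors never add up to at most \<open>2 * \<epsilon>\<close> within the budget \<open>X\<close>, one of the two problems
  needs at least \<open>X\<close> samples. Which one may depend on the round; as the sample complexity asks for
  accuracy from some round on, the later of the two stopping rounds yields a contradiction.\<close>

lemma sample_complexity_class_ge:
  assumes N: "N \<ge> 1" and P: "P1 \<in> \<P>" "P2 \<in> \<P>" and \<epsilon>: "0 < \<epsilon>"
    and gap: "\<And>K A. valid_algorithm N d D K A \<Longrightarrow> real (samples_used orc N K) \<le> X \<Longrightarrow>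
      ennreal (2 * \<epsilon>) < expected_gap orc N d D K A P1 i + expected_gap orc N d D K A P2 i"
  shows "ereal X \<le> (INF M\<in>learning_methods orc N d D. SUP P\<in>\<P>. sample_complexity orc N d D \<epsilon> M P i)"
proof (rule INF_greatest)
  fix M assume M: "M \<in> learning_methods orc N d D"
  show "ereal X \<le> (SUP P\<in>\<P>. sample_complexity orc N d D \<epsilon> M P i)"
  proof (rule ccontr)
    assume "\<not> ?thesis"
    then have "(SUP P\<in>\<P>. sample_complexity orc N d D \<epsilon> M P i) < ereal X" by (simp only: not_le)
    from le_less_trans[OF SUP_upper[OF P(1)] this] le_less_trans[OF SUP_upper[OF P(2)] this]
    obtain K1 K2 where K: "real (samples_used orc N K1) < X" "real (samples_used orc N K2) < X"
      and ok: "\<And>K. K \<ge> K1 \<Longrightarrow> expected_gap orc N d D K (M (samples_used orc N K)) P1 i \<le> ennreal \<epsilon>"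
        "\<And>K. K \<ge> K2 \<Longrightarrow> expected_gap orc N d D K (M (samples_used orc N K)) P2 i \<le> ennreal \<epsilon>"
      unfolding sample_complexity_def Inf_less_iff by (auto simp only: mem_Collect_eq less_ereal.simps)
    define K where "K = max K1 K2"
    have "expected_gap orc N d D K (M (samples_used orc N K)) P1 i +
        expected_gap orc N d D K (M (samples_used orc N K)) P2 i \<le> ennreal \<epsilon> + ennreal \<epsilon>"
      by (intro add_mono ok) (simp_all add: K_def)
    also have "\<dots> = ennreal (2 * \<epsilon>)"
      using \<epsilon> by (simp flip: ennreal_plus)
    also have "\<dots> < expected_gap orc N d D K (M (samples_used orc N K)) P1 i +
        expected_gap orc N d D K (M (samples_used orc N K)) P2 i"
      using K M by (intro gap) (auto simp: learning_methods_def K_def max_def)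
    finally show False by simp
  qed
qed

text \<open>The pair of problems with opposite biases. The product of the two likelihood ratios of one sample is
  at least \<open>1 - (t j)\<^sup>2\<close>, so about \<open>N / (\<Sum>j. (t j)\<^sup>2)\<close> samples are needed to tell them apart.\<close>

lemma coin_problems_complexity_ge:
  fixes d D :: nat and h :: "rvec \<Rightarrow> real" and g :: "rvec \<Rightarrow> rvec" and s t :: "nat \<Rightarrow> real"
  defines "P \<equiv> \<lambda>\<theta>. coin_problem d D h g s (\<lambda>j. \<theta> * t j)"
  assumes d: "d \<ge> 1" and D: "D \<ge> 1" and N: "N \<ge> 1" and i: "i \<in> {1..N}"
    and s: "\<And>j. 0 \<le> s j" and t: "\<And>j. \<bar>t j\<bar> \<le> 1"
    and P: "P 1 \<in> \<P>" "P (- 1) \<in> \<P>" and wp: "\<And>Q. Q \<in> \<P> \<Longrightarrow> well_posed N d D Q"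
    and sep: "\<And>x. x \<in> Rn d \<Longrightarrow> 4 * \<epsilon> \<le> (objective (P 1) i x - (INF y\<in>Rn d. objective (P 1) i y)) +
      (objective (P (- 1)) i x - (INF y\<in>Rn d. objective (P (- 1)) i y))"
    and \<epsilon>: "0 < \<epsilon>" and X: "X / real N * (\<Sum>j\<in>{1..N}. (t j)\<^sup>2) \<le> 1 / 16"
  shows "ereal X \<le> (INF M\<in>learning_methods orc N d D. SUP P\<in>\<P>. sample_complexity orc N d D \<epsilon> M P i)"
proof (rule sample_complexity_class_ge[OF N P \<epsilon>])
  fix K A
  assume A: "valid_algorithm N d D K A" and K: "real (samples_used orc N K) \<le> X"
  have "real (samples_used orc N K) / real N * (\<Sum>j\<in>{1..N}. (t j)\<^sup>2) \<le> X / real N * (\<Sum>j\<in>{1..N}. (t j)\<^sup>2)"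
    using K by (intro mult_right_mono divide_right_mono sum_nonneg) auto
  with X have budget: "real (samples_used orc N K) / real N * (\<Sum>j\<in>{1..N}. (t j)\<^sup>2) \<le> 1 / 16"
    by linarith
  have t': "\<bar>- t j\<bar> \<le> 1" for j using t by simp
  have meas: "bias_density c \<in> borel_measurable (coin D (s j))" for c j
    using measurable_bias_density[OF D] by (simp add: measurable_cong_sets[OF sets_coin refl])
  have "ennreal (2 * \<epsilon>) < ennreal (5 / 8 * (4 * \<epsilon>))"
    using \<epsilon> by (intro ennreal_lessI) auto
  also have "\<dots> \<le> expected_gap orc N d D K A (P 1) i + expected_gap orc N d D K A (P (- 1)) i"
  proof (rule expected_gap_sum_ge[OF wp[OF P(1)] wp[OF P(2)] A N i])
    show "sample_dist (P 1) = (\<lambda>j. density (coin D (s j)) (\<lambda>x. ennreal (bias_density (t j) x)))"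
      "sample_dist (P (- 1)) = (\<lambda>j. density (coin D (s j)) (\<lambda>x. ennreal (bias_density (- t j) x)))"
      by (simp_all add: P_def biased_coin_def)
    show "prob_space (density (coin D (s j)) (\<lambda>x. ennreal (bias_density (t j) x)))"
      "prob_space (density (coin D (s j)) (\<lambda>x. ennreal (bias_density (- t j) x)))" for j
      using prob_space_biased_coin[OF D s[of j] t[of j]] prob_space_biased_coin[OF D s[of j] t'[of j]]
      by (simp_all add: biased_coin_def)
  qed (use budget sep in \<open>simp_all add: P_def prob_space_coin meas bias_density_nonneg t t' bias_density_prod\<close>)
  finally show "ennreal (2 * \<epsilon>) < expected_gap orc N d D K A (P 1) i + expected_gap orc N d D K A (P (- 1)) i" .
qed

text \<open>At least one oracle call is needed. For the synchronous oracle this is a bound by \<open>N\<close>, which covers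
  the accuracies that are too coarse for the two-point construction.\<close>

lemma samples_used_1_le_complexity:
  assumes "N \<ge> 1" and "P \<in> \<P>"
  shows "ereal (real (samples_used orc N 1)) \<le>
    (INF M\<in>learning_methods orc N d D. SUP P\<in>\<P>. sample_complexity orc N d D \<epsilon> M P i)"
proof (intro INF_greatest SUP_upper2[OF assms(2)])
  fix M
  have "samples_used orc N 1 \<le> samples_used orc N K" if "1 \<le> samples_used orc N K" for K
    using that by (cases orc) (auto simp: samples_used_def Suc_le_eq)
  then show "ereal (real (samples_used orc N 1)) \<le> sample_complexity orc N d D \<epsilon> M P i"
    unfolding sample_complexity_def by (auto intro!: Inf_greatest)
qed

lemma INF_objective:
  assumes "minimizers N d P xs" and "i \<in> {1..N}"
  shows "(INF y\<in>Rn d. objective P i y) = objective P i (xs i)"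
  using assms unfolding minimizers_def by (intro cInf_eq_minimum) auto

section \<open>The hard convex instances\<close>

text \<open>A flat valley of half-width \<open>r\<close> with walls of slope \<open>B / 2\<close>. A linear perturbation of smaller
  slope moves the minimizer to the end \<open>r\<close> or \<open>- r\<close> of the valley.\<close>

definition wall :: "real \<Rightarrow> real \<Rightarrow> rvec \<Rightarrow> real" where
  "wall r B x = B / 2 * max (\<bar>x 0\<bar> - r) 0"

definition wall_slope :: "nat \<Rightarrow> real \<Rightarrow> real \<Rightarrow> rvec \<Rightarrow> rvec" where
  "wall_slope d r B x = axis_vec d (if r < x 0 then B / 2 else if x 0 < - r then - B / 2 else 0)"

lemma measurable_wall:
  assumes "d \<ge> 1"
  shows "wall r B \<in> borel_measurable (Rn_borel d)" and "wall_slope d r B \<in> Rn_borel d \<rightarrow>\<^sub>M Rn_borel d"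
proof -
  have [measurable]: "(\<lambda>x. x 0) \<in> borel_measurable (Rn_borel d)"
    using assms by (intro measurable_coord) simp
  show "wall r B \<in> borel_measurable (Rn_borel d)"
    unfolding wall_def[abs_def] by measurable
  have "(\<lambda>x :: rvec. if r < x 0 then B / 2 else if x 0 < - r then - B / 2 else 0) \<in> borel_measurable (Rn_borel d)"
    by measurable
  from measurable_compose[OF this measurable_axis_vec]
  show "wall_slope d r B \<in> Rn_borel d \<rightarrow>\<^sub>M Rn_borel d"
    unfolding wall_slope_def[abs_def] .
qed

lemma has_subgradient_wall:
  assumes "d \<ge> 1" "0 < B" "0 < r"
  shows "has_subgradient d (wall r B) x (wall_slope d r B x)"
  unfolding has_subgradient_def
proof
  fix y
  define a where "a = (if r < x 0 then B / 2 else if x 0 < - r then - B / 2 else 0)"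
  have "(\<Sum>c<d. wall_slope d r B x c * (y c - x c)) = (\<Sum>c<d. if c = 0 then a * (y 0 - x 0) else 0)"
    by (intro sum.cong) (auto simp: wall_slope_def axis_vec_def a_def)
  also have "\<dots> = a * (y 0 - x 0)"
    using assms by (simp add: sum.delta)
  finally have eq: "(\<Sum>c<d. wall_slope d r B x c * (y c - x c)) = a * (y 0 - x 0)" .
  have "max (\<bar>x 0\<bar> - r) 0 + (a / (B / 2)) * (y 0 - x 0) \<le> max (\<bar>y 0\<bar> - r) 0"
    using assms by (auto simp: a_def)
  then have "B / 2 * (max (\<bar>x 0\<bar> - r) 0 + (a / (B / 2)) * (y 0 - x 0)) \<le> B / 2 * max (\<bar>y 0\<bar> - r) 0"
    using assms by (intro mult_left_mono) auto
  moreover have "B / 2 * (max (\<bar>x 0\<bar> - r) 0 + (a / (B / 2)) * (y 0 - x 0)) =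
      B / 2 * max (\<bar>x 0\<bar> - r) 0 + a * (y 0 - x 0)"
    using assms by (simp add: field_simps)
  ultimately show "wall r B x + (\<Sum>c<d. wall_slope d r B x c * (y c - x c)) \<le> wall r B y"
    by (simp add: wall_def eq)
qed

text \<open>All agents share the minimizer \<open>\<theta> * r\<close> on the first axis, which is a minimizer of the flat
  objectives as well. So every agent loses nothing at the minimizers of the others, and it is the
  condition on the gradients that limits how fast the drift may vary between agents. The walls and the coins
  each use half of the gradient bound \<open>B\<close>.\<close>

lemma wall_coin_problem:
  fixes d D :: nat and r B :: real and s t :: "nat \<Rightarrow> real" and \<theta> :: real
  defines "P \<equiv> coin_problem d D (wall r B) (wall_slope d r B) s (\<lambda>j. \<theta> * t j)"
  assumes d: "d \<ge> 1" and D: "D \<ge> 1" and r: "0 < r" and B: "0 < B" and \<theta>: "\<theta> = 1 \<or> \<theta> = - 1"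
    and s: "\<And>j. 0 \<le> s j" "\<And>j. s j \<le> B / 2" and t: "\<And>j. 0 \<le> t j" "\<And>j. t j \<le> 1"
    and b: "\<And>j k. j \<in> {1..N} \<Longrightarrow> k \<in> {1..N} \<Longrightarrow> \<bar>s j * t j - s k * t k\<bar> \<le> b j k / r"
  shows "P \<in> convex_problems N d D r b B"
    and "i \<in> {1..N} \<Longrightarrow> objective P i x - (INF y\<in>Rn d. objective P i y) =
      wall r B x - s i * t i * \<theta> * x 0 + r * (s i * t i)"
proof -
  have \<theta>t: "\<bar>\<theta> * t j\<bar> \<le> 1" for j using \<theta> t[of j] by auto
  have obj: "objective P j x = wall r B x - s j * (\<theta> * t j) * x 0" for j x
    unfolding P_def by (rule objective_coin_problem[OF d D s(1) \<theta>t])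
  have grad: "mean_grad d P j x = (\<lambda>c\<in>{..<d}. wall_slope d r B x c - (if c = 0 then s j * (\<theta> * t j) else 0))" for j x
    unfolding P_def by (rule mean_grad_coin_problem[OF d D s(1) \<theta>t])
  have wp: "well_posed N d D P"
    unfolding P_def using d D s \<theta>t measurable_wall[OF d] has_subgradient_wall[OF d B r]
    by (intro well_posed_coin_problem) auto
  define xs where "xs = (\<lambda>j :: nat. axis_vec d (\<theta> * r))"
  have obj_xs: "objective P j (xs k) = - (r * (s j * t j))" for j k
    using \<theta> r d by (auto simp: obj xs_def wall_def)
  have drift: "0 \<le> s j * t j" "s j * t j \<le> B / 2" for j
    using s[of j] t[of j] mult_mono[of "s j" "B / 2" "t j" 1] B by auto
  have obj_ge: "- (r * (s j * t j)) \<le> objective P j x" for j x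
  proof -
    have "s j * (\<theta> * t j) * x 0 = s j * t j * (\<theta> * x 0)" by simp
    also have "\<dots> \<le> s j * t j * \<bar>x 0\<bar>"
      using \<theta> drift(1)[of j] by (intro mult_left_mono) auto
    also have "\<dots> \<le> s j * t j * (max (\<bar>x 0\<bar> - r) 0 + r)"
      using drift by (intro mult_left_mono) auto
    also have "\<dots> \<le> wall r B x + r * (s j * t j)"
      using mult_right_mono[OF drift(2)[of j], of "max (\<bar>x 0\<bar> - r) 0"] by (simp add: wall_def algebra_simps)
    finally show ?thesis by (simp add: obj)
  qed
  have min: "minimizers N d P xs"
    by (auto simp: minimizers_def obj_xs obj_ge) (simp add: xs_def)
  show "i \<in> {1..N} \<Longrightarrow> objective P i x - (INF y\<in>Rn d. objective P i y) =
      wall r B x - s i * t i * \<theta> * x 0 + r * (s i * t i)"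
    by (simp add: INF_objective[OF min] obj_xs) (simp add: obj algebra_simps)
  have norm_xs: "norm_Rn d (xs j) \<le> r" for j
  proof -
    have "norm_Rn d (xs j) = \<bar>\<theta> * r\<bar>"
      by (rule norm_Rn_axis[OF d]) (simp add: xs_def axis_vec_def)
    then show ?thesis using \<theta> r by auto
  qed
  have convex: "convex_Rn d (objective P j)" if "j \<in> {1..N}" for j
    using wp that by (intro convex_Rn_of_subgradients) (auto simp: well_posed_def)
  have moment: "(\<integral>\<^sup>+\<xi>. ennreal ((norm_Rn d (sgrad P x \<xi>))\<^sup>2) \<partial>sample_dist P j) \<le> ennreal (B\<^sup>2)" for j x
  proof -
    define w where "w = (if r < x 0 then B / 2 else if x 0 < - r then - B / 2 else 0)"
    have w: "\<bar>w\<bar> \<le> B / 2" using B by (simp add: w_def)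
    have "norm_Rn d (sgrad P x \<xi>) = \<bar>w - \<xi> 0\<bar>" for \<xi>
      by (rule norm_Rn_axis[OF d]) (simp add: P_def wall_slope_def axis_vec_def w_def)
    then have "(\<integral>\<^sup>+\<xi>. ennreal ((norm_Rn d (sgrad P x \<xi>))\<^sup>2) \<partial>sample_dist P j) =
        (\<integral>\<^sup>+\<xi>. ennreal ((w - \<xi> 0)\<^sup>2) \<partial>biased_coin D (s j) (\<theta> * t j))"
      by (simp add: P_def)
    also have "\<dots> = ennreal ((1 + \<theta> * t j) / 2 * (w - s j)\<^sup>2 + (1 - \<theta> * t j) / 2 * (w - - s j)\<^sup>2)"
      by (rule nn_integral_biased_coin_coord[OF D s(1) \<theta>t]) auto
    also have "\<dots> \<le> ennreal ((1 + \<theta> * t j) / 2 * B\<^sup>2 + (1 - \<theta> * t j) / 2 * B\<^sup>2)"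
      using \<theta>t[of j] w s[of j] B
      by (intro ennreal_leI add_mono mult_left_mono abs_le_square_iff[THEN iffD1]) (auto simp: abs_le_iff)
    also have "\<dots> = ennreal (B\<^sup>2)"
      by (simp add: field_simps)
    finally show ?thesis .
  qed
  have dist: "(dist_Rn d (mean_grad d P j x) (mean_grad d P k x))\<^sup>2 \<le> (b j k / r)\<^sup>2"
    if "j \<in> {1..N}" "k \<in> {1..N}" for j k x
  proof -
    have "dist_Rn d (mean_grad d P j x) (mean_grad d P k x) = \<bar>s k * (\<theta> * t k) - s j * (\<theta> * t j)\<bar>"
      by (rule dist_Rn_axis[OF d]) (auto simp: grad)
    also have "\<dots> = \<bar>s j * t j - s k * t k\<bar>" using \<theta> by auto
    also have "\<dots> \<le> b j k / r" by (rule b[OF that])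
    finally show ?thesis by (intro power_mono) (simp_all add: dist_Rn_nonneg)
  qed
  have bnonneg: "0 \<le> b j k" if "j \<in> {1..N}" "k \<in> {1..N}" for j k
    using order.trans[OF abs_ge_zero b[OF that]] r by (simp add: zero_le_divide_iff)
  show "P \<in> convex_problems N d D r b B"
    unfolding convex_problems_def mem_Collect_eq
  proof (intro conjI exI[of _ xs] ballI)
    show "objective P j (xs k) - objective P j (xs j) \<le> b j k" if "j \<in> {1..N}" "k \<in> {1..N}" for j k
      using bnonneg[OF that] by (simp add: obj_xs)
  qed (rule wp min norm_xs convex moment dist; assumption)+
qed

section \<open>The hard strongly convex instances\<close>

text \<open>With equal strong convexity and smoothness constants the objectives must be translates of
  one quadratic function, up to constants; the drift of an agent is its minimizer divided by
  \<open>r\<^sup>2\<close>.\<close>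

definition quadratic :: "nat \<Rightarrow> real \<Rightarrow> rvec \<Rightarrow> real" where
  "quadratic d r x = (\<Sum>c<d. (x c)\<^sup>2) / (2 * r\<^sup>2)"

definition quadratic_grad :: "nat \<Rightarrow> real \<Rightarrow> rvec \<Rightarrow> rvec" where
  "quadratic_grad d r x = (\<lambda>c\<in>{..<d}. x c / r\<^sup>2)"

lemma measurable_quadratic:
  "quadratic d r \<in> borel_measurable (Rn_borel d)" "quadratic_grad d r \<in> Rn_borel d \<rightarrow>\<^sub>M Rn_borel d"
proof -
  have coord: "(\<lambda>x. x c) \<in> borel_measurable (Rn_borel d)" if "c < d" for c
    using that by (rule measurable_coord)
  show "quadratic d r \<in> borel_measurable (Rn_borel d)"
    unfolding quadratic_def[abs_def]
    by (intro borel_measurable_divide borel_measurable_sum borel_measurable_power borel_measurable_const coord) simp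
  have "(\<lambda>x. \<lambda>c\<in>{..<d}. x c / r\<^sup>2) \<in> Rn_borel d \<rightarrow>\<^sub>M (\<Pi>\<^sub>M c\<in>{..<d}. borel)"
    by (intro measurable_restrict borel_measurable_divide borel_measurable_const coord) simp
  then show "quadratic_grad d r \<in> Rn_borel d \<rightarrow>\<^sub>M Rn_borel d"
    unfolding quadratic_grad_def[abs_def] Rn_borel_def .
qed

lemma quadratic_expansion:
  assumes "r \<noteq> 0"
  shows "quadratic d r y = quadratic d r x + (\<Sum>c<d. quadratic_grad d r x c * (y c - x c)) + (dist_Rn d y x)\<^sup>2 / (2 * r\<^sup>2)"
proof -
  have "(\<Sum>c<d. (y c)\<^sup>2 / (2 * r\<^sup>2)) = (\<Sum>c<d. (x c)\<^sup>2 / (2 * r\<^sup>2) + x c / r\<^sup>2 * (y c - x c) + (y c - x c)\<^sup>2 / (2 * r\<^sup>2))"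
  proof (rule sum.cong[OF refl])
    fix c
    have "(y c)\<^sup>2 = (x c)\<^sup>2 + 2 * x c * (y c - x c) + (y c - x c)\<^sup>2"
      by (simp add: power2_eq_square algebra_simps)
    then show "(y c)\<^sup>2 / (2 * r\<^sup>2) = (x c)\<^sup>2 / (2 * r\<^sup>2) + x c / r\<^sup>2 * (y c - x c) + (y c - x c)\<^sup>2 / (2 * r\<^sup>2)"
      by (simp add: add_divide_distrib)
  qed
  then show ?thesis
    by (simp add: quadratic_def quadratic_grad_def dist_Rn_sq sum.distrib sum_divide_distrib)
qed

text \<open>The excess risk is the scaled squared distance to the agent's minimizer. The noise of the gradients
  is the variance \<open>(s j)\<^sup>2 * (1 - (t j)\<^sup>2)\<close> of the coin, so a fully biased coin is noise-free
  whatever its size.\<close>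

lemma quadratic_coin_problem:
  fixes d D :: nat and r :: real and s t :: "nat \<Rightarrow> real" and \<theta> :: real
  defines "P \<equiv> coin_problem d D (quadratic d r) (quadratic_grad d r) s (\<lambda>j. \<theta> * t j)"
    and "xs \<equiv> \<lambda>j. axis_vec d (r\<^sup>2 * (s j * (\<theta> * t j)))"
  assumes d: "d \<ge> 1" and D: "D \<ge> 1" and r: "0 < r" and \<theta>: "\<theta> = 1 \<or> \<theta> = - 1"
    and s: "\<And>j. 0 \<le> s j" and t: "\<And>j. 0 \<le> t j" "\<And>j. t j \<le> 1"
    and drift: "\<And>j. s j * t j \<le> 1 / r"
    and noise: "\<And>j. (s j)\<^sup>2 * (1 - (t j)\<^sup>2) \<le> \<sigma>\<^sup>2"
    and b: "\<And>j k. j \<in> {1..N} \<Longrightarrow> k \<in> {1..N} \<Longrightarrow> (s j * t j - s k * t k)\<^sup>2 \<le> b j k / r\<^sup>2"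
  shows "P \<in> strongly_convex_problems N d D (1 / r\<^sup>2) (1 / r\<^sup>2) r b \<sigma>"
    and "i \<in> {1..N} \<Longrightarrow> objective P i x - (INF y\<in>Rn d. objective P i y) =
      (dist_Rn d x (xs i))\<^sup>2 / (2 * r\<^sup>2)"
proof -
  define a where "a j = s j * (\<theta> * t j)" for j
  have \<theta>t: "\<bar>\<theta> * t j\<bar> \<le> 1" for j using \<theta> t[of j] by auto
  have \<theta>2: "\<theta>\<^sup>2 = 1" using \<theta> by auto
  have obj: "objective P j x = quadratic d r x - a j * x 0" for j x
    unfolding P_def a_def by (rule objective_coin_problem[OF d D s \<theta>t])
  have grad: "mean_grad d P j x = (\<lambda>c\<in>{..<d}. quadratic_grad d r x c - (if c = 0 then a j else 0))" for j x
    unfolding P_def a_def by (rule mean_grad_coin_problem[OF d D s \<theta>t])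
  have r0: "r \<noteq> 0" using r by simp
  have sub: "has_subgradient d (quadratic d r) x (quadratic_grad d r x)" for x
    unfolding has_subgradient_def
  proof
    show "quadratic d r x + (\<Sum>c<d. quadratic_grad d r x c * (y c - x c)) \<le> quadratic d r y" for y
      by (simp add: quadratic_expansion[OF r0, of d y x])
  qed
  have wp: "well_posed N d D P"
    unfolding P_def by (intro well_posed_coin_problem d D s \<theta>t measurable_quadratic sub)
  have obj_dist: "objective P j x = (dist_Rn d x (xs j))\<^sup>2 / (2 * r\<^sup>2) - r\<^sup>2 * (a j)\<^sup>2 / 2" for j x
  proof -
    have "(dist_Rn d x (xs j))\<^sup>2 = (\<Sum>c<d. (x c)\<^sup>2 + (if c = 0 then (r\<^sup>2 * a j)\<^sup>2 - 2 * (r\<^sup>2 * a j) * x 0 else 0))"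
      unfolding dist_Rn_sq by (intro sum.cong) (auto simp: xs_def axis_vec_def a_def power2_diff)
    also have "\<dots> = (\<Sum>c<d. (x c)\<^sup>2) + ((r\<^sup>2 * a j)\<^sup>2 - 2 * (r\<^sup>2 * a j) * x 0)"
      using d by (simp add: sum.distrib sum.delta)
    finally have eq: "(dist_Rn d x (xs j))\<^sup>2 = \<dots>" .
    have "q / (2 * R) - c * z = (q + ((R * c)\<^sup>2 - 2 * (R * c) * z)) / (2 * R) - R * c\<^sup>2 / 2"
      if "R \<noteq> 0" for q R c z :: real
      using that by (simp add: field_simps power2_eq_square)
    then show ?thesis
      unfolding obj quadratic_def eq using r0 by (simp only: power_not_zero not_False_eq_True)
  qed
  have dist_axis: "dist_Rn d (xs j) (xs k) = \<bar>r\<^sup>2 * (a j - a k)\<bar>" for j k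
    by (rule dist_Rn_axis[OF d]) (auto simp: xs_def axis_vec_def a_def algebra_simps)
  have obj_xs: "objective P j (xs k) = r\<^sup>2 * (a k - a j)\<^sup>2 / 2 - r\<^sup>2 * (a j)\<^sup>2 / 2" for j k
  proof -
    have "(dist_Rn d (xs k) (xs j))\<^sup>2 / (2 * r\<^sup>2) = r\<^sup>2 * (a k - a j)\<^sup>2 / 2"
      unfolding dist_axis using r0 by (simp add: power_mult_distrib power2_eq_square)
    then show ?thesis by (simp only: obj_dist)
  qed
  have min: "minimizers N d P xs"
    unfolding minimizers_def
  proof (intro ballI conjI)
    show "xs j \<in> Rn d" for j by (simp add: xs_def)
    show "objective P j (xs j) \<le> objective P j y" for j y
      unfolding obj_xs by (simp add: obj_dist)
  qed
  show "i \<in> {1..N} \<Longrightarrow> objective P i x - (INF y\<in>Rn d. objective P i y) =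
      (dist_Rn d x (xs i))\<^sup>2 / (2 * r\<^sup>2)"
    by (subst INF_objective[OF min], assumption, subst obj_xs) (simp add: obj_dist)
  have abs_a: "\<bar>a j\<bar> = s j * t j" for j
    using \<theta> s[of j] t[of j] by (auto simp: a_def)
  have norm_xs: "norm_Rn d (xs j) \<le> r" for j
  proof -
    have "norm_Rn d (xs j) = \<bar>r\<^sup>2 * a j\<bar>"
      by (rule norm_Rn_axis[OF d]) (simp add: xs_def axis_vec_def a_def)
    also have "\<dots> = r\<^sup>2 * (s j * t j)" by (simp add: abs_mult abs_a)
    also have "\<dots> \<le> r\<^sup>2 * (1 / r)" by (intro mult_left_mono drift) simp
    also have "\<dots> = r" using r by (simp add: power2_eq_square)
    finally show ?thesis .
  qed
  have strong: "strongly_convex_Rn d (1 / r\<^sup>2) (objective P j)" for j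
    unfolding strongly_convex_Rn_def
  proof (intro ballI)
    fix x y :: rvec and u :: real
    let ?z = "\<lambda>c\<in>{..<d}. (1 - u) * x c + u * y c"
    have "(dist_Rn d ?z (xs j))\<^sup>2 = (\<Sum>c<d. (1 - u) * (x c - xs j c)\<^sup>2 + u * (y c - xs j c)\<^sup>2 - u * (1 - u) * (x c - y c)\<^sup>2)"
      unfolding dist_Rn_sq by (intro sum.cong refl) (simp add: power2_eq_square algebra_simps)
    also have "\<dots> = (1 - u) * (dist_Rn d x (xs j))\<^sup>2 + u * (dist_Rn d y (xs j))\<^sup>2 - u * (1 - u) * (dist_Rn d x y)\<^sup>2"
      unfolding dist_Rn_sq by (simp only: sum.distrib sum_subtractf sum_distrib_left)
    finally have eq: "(dist_Rn d ?z (xs j))\<^sup>2 = \<dots>" .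
    show "objective P j ?z \<le> (1 - u) * objective P j x + u * objective P j y
        - 1 / r\<^sup>2 / 2 * u * (1 - u) * (dist_Rn d x y)\<^sup>2"
      unfolding obj_dist eq using r0 by (simp add: field_simps)
  qed
  have smooth: "smooth_Rn d (1 / r\<^sup>2) (objective P j) (mean_grad d P j)" for j
    unfolding smooth_Rn_def
  proof (intro conjI ballI)
    fix x
    show "mean_grad d P j x \<in> Rn d" by (simp add: grad Rn_def)
    show "has_gradient d (objective P j) x (mean_grad d P j x)"
      unfolding has_gradient_def
    proof (intro allI impI)
      fix e :: real assume e: "0 < e"
      show "\<exists>\<delta>>0. \<forall>y\<in>Rn d. dist_Rn d y x < \<delta> \<longrightarrow>
          \<bar>objective P j y - objective P j x - (\<Sum>c<d. mean_grad d P j x c * (y c - x c))\<bar> \<le> e * dist_Rn d y x"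
      proof (intro exI[of _ "2 * r\<^sup>2 * e"] conjI ballI impI)
        show "0 < 2 * r\<^sup>2 * e" using r e by simp
        fix y assume y: "dist_Rn d y x < 2 * r\<^sup>2 * e"
        have "(\<Sum>c<d. mean_grad d P j x c * (y c - x c)) =
            (\<Sum>c<d. quadratic_grad d r x c * (y c - x c) - (if c = 0 then a j * (y 0 - x 0) else 0))"
          by (intro sum.cong) (auto simp: grad left_diff_distrib)
        also have "\<dots> = (\<Sum>c<d. quadratic_grad d r x c * (y c - x c)) - a j * (y 0 - x 0)"
          using d by (simp add: sum_subtractf sum.delta)
        finally have "objective P j y - objective P j x - (\<Sum>c<d. mean_grad d P j x c * (y c - x c)) =
            (dist_Rn d y x)\<^sup>2 / (2 * r\<^sup>2)"
          by (simp add: obj quadratic_expansion[OF r0, of d y x] right_diff_distrib)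
        moreover have "(dist_Rn d y x)\<^sup>2 / (2 * r\<^sup>2) \<le> e * dist_Rn d y x"
        proof -
          have "(dist_Rn d y x)\<^sup>2 \<le> (2 * r\<^sup>2 * e) * dist_Rn d y x"
            unfolding power2_eq_square[of "dist_Rn d y x"] using y dist_Rn_nonneg
            by (intro mult_right_mono) auto
          then show ?thesis using r by (simp add: divide_le_eq mult_ac)
        qed
        ultimately show "\<bar>objective P j y - objective P j x - (\<Sum>c<d. mean_grad d P j x c * (y c - x c))\<bar>
            \<le> e * dist_Rn d y x"
          by simp
      qed
    qed
    fix y
    have "(dist_Rn d (mean_grad d P j x) (mean_grad d P j y))\<^sup>2 = (dist_Rn d x y / r\<^sup>2)\<^sup>2"
      unfolding power_divide dist_Rn_sq sum_divide_distrib
      by (intro sum.cong) (auto simp: grad quadratic_grad_def power_divide simp flip: diff_divide_distrib)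
    then show "dist_Rn d (mean_grad d P j x) (mean_grad d P j y) \<le> 1 / r\<^sup>2 * dist_Rn d x y"
      using dist_Rn_nonneg by (simp add: power2_eq_iff_nonneg)
  qed
  have variance: "(\<integral>\<^sup>+\<xi>. ennreal ((dist_Rn d (sgrad P x \<xi>) (mean_grad d P j x))\<^sup>2) \<partial>sample_dist P j) \<le> ennreal (\<sigma>\<^sup>2)" for j x
  proof -
    have "dist_Rn d (sgrad P x \<xi>) (mean_grad d P j x) = \<bar>a j - \<xi> 0\<bar>" for \<xi>
      by (rule dist_Rn_axis[OF d]) (simp add: P_def[symmetric] grad, simp add: P_def)
    then have "(\<integral>\<^sup>+\<xi>. ennreal ((dist_Rn d (sgrad P x \<xi>) (mean_grad d P j x))\<^sup>2) \<partial>sample_dist P j) =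
        (\<integral>\<^sup>+\<xi>. ennreal ((a j - \<xi> 0)\<^sup>2) \<partial>biased_coin D (s j) (\<theta> * t j))"
      by (simp add: P_def)
    also have "\<dots> = ennreal ((1 + \<theta> * t j) / 2 * (a j - s j)\<^sup>2 + (1 - \<theta> * t j) / 2 * (a j - - s j)\<^sup>2)"
      by (rule nn_integral_biased_coin_coord[OF D s \<theta>t]) auto
    also have "(1 + \<theta> * t j) / 2 * (a j - s j)\<^sup>2 + (1 - \<theta> * t j) / 2 * (a j - - s j)\<^sup>2 =
        (s j)\<^sup>2 * (1 - \<theta>\<^sup>2 * (t j)\<^sup>2)"
      by (simp add: a_def power2_eq_square field_simps)
    also have "ennreal \<dots> \<le> ennreal (\<sigma>\<^sup>2)"
      using noise[of j] by (intro ennreal_leI) (simp add: \<theta>2)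
    finally show ?thesis .
  qed
  have a_diff: "(a j - a k)\<^sup>2 \<le> b j k / r\<^sup>2" if "j \<in> {1..N}" "k \<in> {1..N}" for j k
  proof -
    have "a j - a k = \<theta> * (s j * t j - s k * t k)" by (simp add: a_def algebra_simps)
    then have "(a j - a k)\<^sup>2 = (s j * t j - s k * t k)\<^sup>2" by (simp add: power_mult_distrib \<theta>2)
    with b[OF that] show ?thesis by simp
  qed
  have dist: "(dist_Rn d (mean_grad d P j x) (mean_grad d P k x))\<^sup>2 \<le> 1 / r\<^sup>2 * b j k"
    if "j \<in> {1..N}" "k \<in> {1..N}" for j k x
  proof -
    have "dist_Rn d (mean_grad d P j x) (mean_grad d P k x) = \<bar>a k - a j\<bar>"
      by (rule dist_Rn_axis[OF d]) (auto simp: grad)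
    then show ?thesis using a_diff[OF that] by (simp add: power2_commute)
  qed
  have cross: "objective P j (xs k) - objective P j (xs j) \<le> b j k"
    if "j \<in> {1..N}" "k \<in> {1..N}" for j k
  proof -
    have "(a k - a j)\<^sup>2 * r\<^sup>2 \<le> b j k"
      using a_diff[OF that] r by (simp add: pos_le_divide_eq power2_commute)
    moreover have "0 \<le> (a k - a j)\<^sup>2 * r\<^sup>2" by simp
    ultimately have "(a k - a j)\<^sup>2 * r\<^sup>2 / 2 \<le> b j k" by linarith
    then show ?thesis by (simp add: obj_xs mult.commute)
  qed
  show "P \<in> strongly_convex_problems N d D (1 / r\<^sup>2) (1 / r\<^sup>2) r b \<sigma>"
    unfolding strongly_convex_problems_def mem_Collect_eq
  proof (intro conjI exI[of _ xs] exI[of _ "mean_grad d P"] ballI)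
  qed (rule wp min norm_xs strong smooth variance cross dist; assumption)+
qed

section \<open>The lower bounds\<close>

text \<open>The weight \<open>\<phi> j\<close> says how strongly the objective of agent \<open>j\<close> follows that of agent \<open>i\<close>. It must
  vanish for the agents with \<open>b i j \<ge> 4 * \<epsilon>\<close>, which then know nothing about the hypothesis. It cannot
  jump to 0, because two agents on either side of that threshold may be close to each other; truncating
  \<open>4 * \<epsilon> - b i j\<close> at 0 makes it 1-Lipschitz, by the triangle inequality.\<close>

lemma proximity_weights:
  fixes b :: "nat \<Rightarrow> nat \<Rightarrow> real"
  assumes \<epsilon>: "0 < \<epsilon>" and i: "i \<in> {1..N}"
    and nonneg: "\<And>j k. j \<in> {1..N} \<Longrightarrow> k \<in> {1..N} \<Longrightarrow> 0 \<le> b j k"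
    and sym: "\<And>j k. j \<in> {1..N} \<Longrightarrow> k \<in> {1..N} \<Longrightarrow> b j k = b k j"
    and tri: "\<And>j k l. j \<in> {1..N} \<Longrightarrow> k \<in> {1..N} \<Longrightarrow> l \<in> {1..N} \<Longrightarrow> b j k \<le> b j l + b l k"
  obtains \<phi> :: "nat \<Rightarrow> real" where "\<phi> i = 4 * \<epsilon>" "\<And>j. 0 \<le> \<phi> j" "\<And>j. \<phi> j \<le> 4 * \<epsilon>"
    "\<And>j k. j \<in> {1..N} \<Longrightarrow> k \<in> {1..N} \<Longrightarrow> \<bar>\<phi> j - \<phi> k\<bar> \<le> b j k"
    "card {j \<in> {1..N}. 0 < \<phi> j} \<le> num_close N \<epsilon> (\<lambda>i j. b i j / 4) i + 1"
proof -
  \<comment> \<open>As \<open>b i i\<close> may be positive, the distance of agent \<open>i\<close> to itself is reset to 0, which keeps the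
    triangle inequality. This may add agent \<open>i\<close> to the informed agents, hence the \<open>+ 1\<close> in the
    cardinality bound. Indices outside \<open>{1..N}\<close> get weight 0.\<close>
  define dst where "dst j = (if j = i then 0 else if j \<in> {1..N} then b i j else 4 * \<epsilon>)" for j
  define \<phi> where "\<phi> j = max 0 (4 * \<epsilon> - dst j)" for j
  have dst0: "0 \<le> dst j" for j
    using nonneg[OF i, of j] \<epsilon> by (simp add: dst_def)
  have lip: "\<bar>dst j - dst k\<bar> \<le> b j k" if "j \<in> {1..N}" "k \<in> {1..N}" for j k
    using nonneg[OF that] sym[OF i that(1)] sym[OF that] tri[OF i that(1,2)] tri[OF i that(2,1)] that
    by (cases "j = i"; cases "k = i") (auto simp: dst_def abs_le_iff)
  have 1: "\<phi> i = 4 * \<epsilon>" using \<epsilon> by (simp add: \<phi>_def dst_def)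
  have 2: "0 \<le> \<phi> j" "\<phi> j \<le> 4 * \<epsilon>" for j
    using dst0[of j] \<epsilon> by (auto simp: \<phi>_def)
  have 3: "\<bar>\<phi> j - \<phi> k\<bar> \<le> b j k" if "j \<in> {1..N}" "k \<in> {1..N}" for j k
    using lip[OF that] by (auto simp: \<phi>_def max_def abs_le_iff)
  have "{j \<in> {1..N}. 0 < \<phi> j} \<subseteq> insert i {j \<in> {1..N}. b i j / 4 \<le> \<epsilon>}"
    by (auto simp: \<phi>_def dst_def split: if_splits)
  then have "card {j \<in> {1..N}. 0 < \<phi> j} \<le> card (insert i {j \<in> {1..N}. b i j / 4 \<le> \<epsilon>})"
    by (intro card_mono) auto
  also have "\<dots> \<le> card {j \<in> {1..N}. b i j / 4 \<le> \<epsilon>} + 1"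
    by (simp add: card_insert_if)
  also have "card {j \<in> {1..N}. b i j / 4 \<le> \<epsilon>} = num_close N \<epsilon> (\<lambda>i j. b i j / 4) i"
    by (simp add: num_close_def Int_def)
  finally have 4: "card {j \<in> {1..N}. 0 < \<phi> j} \<le> num_close N \<epsilon> (\<lambda>i j. b i j / 4) i + 1" .
  show thesis by (rule that[of \<phi>]) (fact 1 2 3 4)+
qed

text \<open>When all informed agents have the same bias \<open>m\<close>, the possible extra agent costs at most a factor 2,
  provided that at least one agent is counted.\<close>

lemma budget_of_weights:
  fixes m :: real and \<phi> :: "nat \<Rightarrow> real"
  assumes "card {j \<in> {1..N}. 0 < \<phi> j} \<le> n + 1" and "1 \<le> n" and "m \<noteq> 0" and "1 \<le> N"
  shows "real N / (32 * m\<^sup>2 * real n) / real N * (\<Sum>j\<in>{1..N}. (if 0 < \<phi> j then m else 0)\<^sup>2) \<le> 1 / 16"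
proof -
  have "(\<Sum>j\<in>{1..N}. (if 0 < \<phi> j then m else 0)\<^sup>2) = (\<Sum>j\<in>{j \<in> {1..N}. 0 < \<phi> j}. m\<^sup>2)"
    by (intro sum.mono_neutral_cong_right) auto
  also have "\<dots> = real (card {j \<in> {1..N}. 0 < \<phi> j}) * m\<^sup>2" by simp
  also have "\<dots> \<le> real (2 * n) * m\<^sup>2"
    using assms(1,2) by (intro mult_right_mono) auto
  finally have "real N / (32 * m\<^sup>2 * real n) / real N * (\<Sum>j\<in>{1..N}. (if 0 < \<phi> j then m else 0)\<^sup>2)
      \<le> real N / (32 * m\<^sup>2 * real n) / real N * (real (2 * n) * m\<^sup>2)"
    by (intro mult_left_mono) auto
  also have "\<dots> = 1 / 16" using assms(2-4) by (simp add: field_simps)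
  finally show ?thesis .
qed

text \<open>The drift \<open>\<phi> j / r\<close> meets the gradient condition because \<open>\<phi>\<close> is 1-Lipschitz, and makes an error
  of \<open>4 * \<epsilon>\<close> for agent \<open>i\<close> at the centre of the valley. With coins of size up to \<open>B / 2\<close>, the bias
  needed for this drift is \<open>m = 8 * \<epsilon> / (r * B)\<close>. If this exceeds 1 there is no such coin; then the
  oracle is synchronous and the bound is at most \<open>N\<close>.\<close>

lemma convex_lower_bound:
  fixes b :: "nat \<Rightarrow> nat \<Rightarrow> real"
  assumes N: "N \<ge> 1" and d: "d \<ge> 1" and D: "D \<ge> 1" and \<epsilon>: "0 < \<epsilon>" and r: "0 < r" and B: "0 < B"
    and i: "i \<in> {1..N}"
    and nonneg: "\<And>j k. j \<in> {1..N} \<Longrightarrow> k \<in> {1..N} \<Longrightarrow> 0 \<le> b j k"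
    and sym: "\<And>j k. j \<in> {1..N} \<Longrightarrow> k \<in> {1..N} \<Longrightarrow> b j k = b k j"
    and tri: "\<And>j k l. j \<in> {1..N} \<Longrightarrow> k \<in> {1..N} \<Longrightarrow> l \<in> {1..N} \<Longrightarrow> b j k \<le> b j l + b l k"
    and small: "orc = Asynchronous \<Longrightarrow> \<epsilon> \<le> r * B / 8"
  shows "ereal (1 / 2048 * r\<^sup>2 * B\<^sup>2 * real N / (\<epsilon>\<^sup>2 * real (num_close N \<epsilon> (\<lambda>i j. b i j / 4) i)))
    \<le> (INF M\<in>learning_methods orc N d D. SUP P\<in>convex_problems N d D r b B. sample_complexity orc N d D \<epsilon> M P i)"
    (is "ereal ?bound \<le> ?complexity")
proof -
  define n where "n = num_close N \<epsilon> (\<lambda>i j. b i j / 4) i"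
  define m where "m = 8 * \<epsilon> / (r * B)"
  have m: "0 < m" using \<epsilon> r B by (simp add: m_def)
  have bound: "?bound = real N / (32 * m\<^sup>2 * real n)"
    using \<epsilon> r B by (simp add: n_def[symmetric] m_def power2_eq_square mult_ac)
  show ?thesis
  proof (cases "n \<ge> 1 \<and> m \<le> 1")
    case True
    obtain \<phi> :: "nat \<Rightarrow> real" where \<phi>: "\<phi> i = 4 * \<epsilon>" "\<And>j. 0 \<le> \<phi> j" "\<And>j. \<phi> j \<le> 4 * \<epsilon>"
      "\<And>j k. j \<in> {1..N} \<Longrightarrow> k \<in> {1..N} \<Longrightarrow> \<bar>\<phi> j - \<phi> k\<bar> \<le> b j k"
      "card {j \<in> {1..N}. 0 < \<phi> j} \<le> n + 1"
      using proximity_weights[where b = b, OF \<epsilon> i nonneg sym tri] unfolding n_def by blast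
    define s where "s j = \<phi> j / (r * m)" for j
    define t where "t j = (if 0 < \<phi> j then m else 0)" for j
    have st: "s j * t j = \<phi> j / r" for j
      using \<phi>(2)[of j] m r by (auto simp: s_def t_def)
    have s: "0 \<le> s j" "s j \<le> B / 2" for j
    proof -
      show "0 \<le> s j" using \<phi>(2)[of j] m r by (simp add: s_def)
      have "s j \<le> 4 * \<epsilon> / (r * m)"
        unfolding s_def using \<phi>(3)[of j] m r by (intro divide_right_mono) auto
      also have "\<dots> = B / 2" using \<epsilon> r B by (simp add: m_def)
      finally show "s j \<le> B / 2" .
    qed
    have t: "0 \<le> t j" "t j \<le> 1" for j using m True by (auto simp: t_def)
    have drift: "\<bar>s j * t j - s k * t k\<bar> \<le> b j k / r" if "j \<in> {1..N}" "k \<in> {1..N}" for j k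
      using divide_right_mono[OF \<phi>(4)[OF that], of r] r by (simp add: st flip: diff_divide_distrib)
    have wall_nonneg: "0 \<le> wall r B x" for x using B by (simp add: wall_def)
    show ?thesis
      unfolding bound
    proof (rule coin_problems_complexity_ge[where s = s and t = t and h = "wall r B" and g = "wall_slope d r B",
          OF d D N i s(1) _ _ _ _ _ \<epsilon>])
      show "\<bar>t j\<bar> \<le> 1" for j using t[of j] by simp
      show "coin_problem d D (wall r B) (wall_slope d r B) s (\<lambda>j. 1 * t j) \<in> convex_problems N d D r b B"
        "coin_problem d D (wall r B) (wall_slope d r B) s (\<lambda>j. - 1 * t j) \<in> convex_problems N d D r b B"
        by (rule wall_coin_problem(1)[OF d D r B _ s t drift]; simp)+
      show "well_posed N d D Q" if "Q \<in> convex_problems N d D r b B" for Q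
        using that by (simp add: convex_problems_def)
      have gap: "objective (coin_problem d D (wall r B) (wall_slope d r B) s (\<lambda>j. \<theta> * t j)) i x -
          (INF y\<in>Rn d. objective (coin_problem d D (wall r B) (wall_slope d r B) s (\<lambda>j. \<theta> * t j)) i y) =
          wall r B x - s i * t i * \<theta> * x 0 + r * (s i * t i)" if "\<theta> = 1 \<or> \<theta> = - 1" for \<theta> x
        by (rule wall_coin_problem(2)[where N = N and b = b, OF d D r B that s t drift i])
      have "r * (s i * t i) = 4 * \<epsilon>" using r \<phi>(1) by (simp add: st)
      then show "4 * \<epsilon> \<le> objective (coin_problem d D (wall r B) (wall_slope d r B) s (\<lambda>j. 1 * t j)) i x -
          (INF y\<in>Rn d. objective (coin_problem d D (wall r B) (wall_slope d r B) s (\<lambda>j. 1 * t j)) i y) +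
          (objective (coin_problem d D (wall r B) (wall_slope d r B) s (\<lambda>j. - 1 * t j)) i x -
          (INF y\<in>Rn d. objective (coin_problem d D (wall r B) (wall_slope d r B) s (\<lambda>j. - 1 * t j)) i y))" for x
        unfolding gap[OF disjI1[OF refl]] gap[OF disjI2[OF refl]]
        using wall_nonneg[of x] \<epsilon> by simp
      show "real N / (32 * m\<^sup>2 * real n) / real N * (\<Sum>j\<in>{1..N}. (t j)\<^sup>2) \<le> 1 / 16"
        unfolding t_def using budget_of_weights[OF \<phi>(5), of m] True m N by simp
    qed
  next
    case False
    have "coin_problem d D (wall r B) (wall_slope d r B) (\<lambda>_. 0) (\<lambda>j. 1 * 0) \<in> convex_problems N d D r b B"
      by (rule wall_coin_problem(1)[OF d D r B]) (use B r nonneg in auto)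
    from samples_used_1_le_complexity[OF N this]
    have one: "ereal (real (samples_used orc N 1)) \<le> ?complexity" .
    have "?bound \<le> real (samples_used orc N 1)"
    proof (cases "n \<ge> 1")
      case True
      with False have m1: "1 < m" by simp
      then have "orc = Synchronous"
        using small r B by (cases orc) (auto simp: m_def field_simps)
      moreover have "1 \<le> 32 * m\<^sup>2 * real n"
        using m1 True mult_mono[of 1 "m\<^sup>2" 1 "real n"] by (simp add: one_le_power)
      then have "real N / (32 * m\<^sup>2 * real n) \<le> real N / 1" using m True by (intro divide_left_mono) auto
      ultimately show ?thesis unfolding bound by (simp add: samples_used_def)
    next
      case False
      then have "n = 0" by simp
      then show ?thesis unfolding bound by simp
    qed
    then show ?thesis using one by (meson ereal_less_eq(3) order_trans)
  qed
qed

text \<open>The minimizers are placed at \<open>\<plusminus> r * sqrt (\<phi> j)\<close>; the square root turns the Lipschitz property of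
  \<open>\<phi>\<close> into the bound on squared differences of gradients. With coins of size at most \<open>\<sigma>\<close> this takes
  the bias \<open>2 * sqrt \<epsilon> / (r * \<sigma>)\<close>. If this exceeds 1, deterministic samples (bias 1) are used
  instead: then the algorithm fails simply because it has met no informed agent.\<close>

lemma strongly_convex_lower_bound:
  fixes b :: "nat \<Rightarrow> nat \<Rightarrow> real"
  assumes N: "N \<ge> 1" and d: "d \<ge> 1" and D: "D \<ge> 1" and \<epsilon>: "0 < \<epsilon>" "\<epsilon> \<le> 1 / 4" and r: "0 < r" and \<sigma>: "0 < \<sigma>"
    and i: "i \<in> {1..N}"
    and nonneg: "\<And>j k. j \<in> {1..N} \<Longrightarrow> k \<in> {1..N} \<Longrightarrow> 0 \<le> b j k"
    and sym: "\<And>j k. j \<in> {1..N} \<Longrightarrow> k \<in> {1..N} \<Longrightarrow> b j k = b k j"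
    and tri: "\<And>j k l. j \<in> {1..N} \<Longrightarrow> k \<in> {1..N} \<Longrightarrow> l \<in> {1..N} \<Longrightarrow> b j k \<le> b j l + b l k"
  shows "ereal (1 / 128 * r\<^sup>2 * \<sigma>\<^sup>2 * real N / (\<epsilon> * real (num_close N \<epsilon> (\<lambda>i j. b i j / 4) i)))
    \<le> (INF M\<in>learning_methods orc N d D.
        SUP P\<in>strongly_convex_problems N d D (1 / r\<^sup>2) (1 / r\<^sup>2) r b \<sigma>. sample_complexity orc N d D \<epsilon> M P i)"
    (is "ereal ?bound \<le> ?complexity")
proof -
  let ?P = "\<lambda>s t. coin_problem d D (quadratic d r) (quadratic_grad d r) s t"
  define n where "n = num_close N \<epsilon> (\<lambda>i j. b i j / 4) i"
  define m where "m = min 1 (2 * sqrt \<epsilon> / (r * \<sigma>))"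
  have m: "0 < m" "m \<le> 1" using \<epsilon> r \<sigma> by (auto simp: m_def)
  show ?thesis
  proof (cases "n \<ge> 1")
    case True
    have "m\<^sup>2 \<le> (2 * sqrt \<epsilon> / (r * \<sigma>))\<^sup>2" using m by (intro power_mono) (auto simp: m_def)
    then have "m\<^sup>2 \<le> 4 * \<epsilon> / (r\<^sup>2 * \<sigma>\<^sup>2)" using \<epsilon> by (simp add: power_divide power_mult_distrib)
    then have m2: "r\<^sup>2 * \<sigma>\<^sup>2 * m\<^sup>2 \<le> 4 * \<epsilon>" using r \<sigma> by (simp add: field_simps)
    have bound: "?bound \<le> real N / (32 * m\<^sup>2 * real n)"
    proof -
      have "?bound = r\<^sup>2 * \<sigma>\<^sup>2 * m\<^sup>2 * (real N / (128 * \<epsilon> * m\<^sup>2 * real n))"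
        using m by (simp add: n_def[symmetric])
      also have "\<dots> \<le> 4 * \<epsilon> * (real N / (128 * \<epsilon> * m\<^sup>2 * real n))"
        using \<epsilon> by (intro mult_right_mono m2) auto
      also have "\<dots> = real N / (32 * m\<^sup>2 * real n)" using \<epsilon> by simp
      finally show ?thesis .
    qed
    obtain \<phi> :: "nat \<Rightarrow> real" where \<phi>: "\<phi> i = 4 * \<epsilon>" "\<And>j. 0 \<le> \<phi> j" "\<And>j. \<phi> j \<le> 4 * \<epsilon>"
      "\<And>j k. j \<in> {1..N} \<Longrightarrow> k \<in> {1..N} \<Longrightarrow> \<bar>\<phi> j - \<phi> k\<bar> \<le> b j k"
      "card {j \<in> {1..N}. 0 < \<phi> j} \<le> n + 1"
      using proximity_weights[where b = b, OF \<epsilon>(1) i nonneg sym tri] unfolding n_def by blast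
    define s where "s j = sqrt (\<phi> j) / (r * m)" for j
    define t where "t j = (if 0 < \<phi> j then m else 0)" for j
    have st: "s j * t j = sqrt (\<phi> j) / r" for j
      using \<phi>(2)[of j] m r by (auto simp: s_def t_def)
    have s: "0 \<le> s j" for j using \<phi>(2)[of j] m r by (simp add: s_def)
    have t: "0 \<le> t j" "t j \<le> 1" for j using m by (auto simp: t_def)
    have drift: "s j * t j \<le> 1 / r" for j
      unfolding st using \<phi>(3)[of j] \<epsilon> r by (intro divide_right_mono) auto
    have noise: "(s j)\<^sup>2 * (1 - (t j)\<^sup>2) \<le> \<sigma>\<^sup>2" for j
    proof (cases "0 < \<phi> j \<and> m < 1")
      case True
      then have m_eq: "m = 2 * sqrt \<epsilon> / (r * \<sigma>)" by (auto simp: m_def min_def split: if_splits)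
      have "(s j)\<^sup>2 * (1 - (t j)\<^sup>2) \<le> (s j)\<^sup>2" using t[of j] by (simp add: mult_left_le)
      also have "(s j)\<^sup>2 = \<phi> j / (r\<^sup>2 * m\<^sup>2)"
        using \<phi>(2)[of j] by (simp add: s_def power_divide power_mult_distrib)
      also have "\<dots> \<le> 4 * \<epsilon> / (r\<^sup>2 * m\<^sup>2)"
        using \<phi>(3)[of j] by (intro divide_right_mono) auto
      also have "\<dots> = \<sigma>\<^sup>2"
        using \<epsilon> r \<sigma> by (simp add: m_eq power_divide power_mult_distrib)
      finally show ?thesis .
    next
      case False
      then have "\<phi> j = 0 \<or> m = 1" using \<phi>(2)[of j] m by linarith
      then have "(s j)\<^sup>2 * (1 - (t j)\<^sup>2) = 0"
        using \<phi>(2)[of j] by (elim disjE) (simp_all add: s_def t_def)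
      then show ?thesis by (simp only: zero_le_power2)
    qed
    have b: "(s j * t j - s k * t k)\<^sup>2 \<le> b j k / r\<^sup>2" if "j \<in> {1..N}" "k \<in> {1..N}" for j k
    proof -
      have sq: "(sqrt u - sqrt v)\<^sup>2 \<le> \<bar>u - v\<bar>" if "0 \<le> u" "0 \<le> v" for u v :: real
      proof -
        have "(sqrt u - sqrt v)\<^sup>2 = \<bar>sqrt u - sqrt v\<bar> * \<bar>sqrt u - sqrt v\<bar>"
          by (simp add: power2_eq_square)
        also have "\<dots> \<le> \<bar>sqrt u - sqrt v\<bar> * \<bar>sqrt u + sqrt v\<bar>"
          using real_sqrt_ge_zero[OF that(1)] real_sqrt_ge_zero[OF that(2)]
          by (intro mult_left_mono) linarith+
        also have "\<dots> = \<bar>(sqrt u - sqrt v) * (sqrt u + sqrt v)\<bar>" by (simp only: abs_mult)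
        also have "(sqrt u - sqrt v) * (sqrt u + sqrt v) = u - v"
          using that by (simp add: algebra_simps)
        finally show ?thesis .
      qed
      have "(s j * t j - s k * t k)\<^sup>2 = (sqrt (\<phi> j) - sqrt (\<phi> k))\<^sup>2 / r\<^sup>2"
        by (simp add: st power_divide flip: diff_divide_distrib)
      also have "\<dots> \<le> b j k / r\<^sup>2"
        using order.trans[OF sq[OF \<phi>(2)[of j] \<phi>(2)[of k]] \<phi>(4)[OF that]] by (intro divide_right_mono) auto
      finally show ?thesis .
    qed
    have "ereal (real N / (32 * m\<^sup>2 * real n)) \<le> ?complexity"
    proof (rule coin_problems_complexity_ge[where s = s and t = t and h = "quadratic d r" and g = "quadratic_grad d r",
          OF d D N i s _ _ _ _ _ \<epsilon>(1)])
      show "\<bar>t j\<bar> \<le> 1" for j using t[of j] by simp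
      show "?P s (\<lambda>j. 1 * t j) \<in> strongly_convex_problems N d D (1 / r\<^sup>2) (1 / r\<^sup>2) r b \<sigma>"
        "?P s (\<lambda>j. - 1 * t j) \<in> strongly_convex_problems N d D (1 / r\<^sup>2) (1 / r\<^sup>2) r b \<sigma>"
        by (rule quadratic_coin_problem(1)[OF d D r _ s t drift noise b]; simp)+
      show "well_posed N d D Q" if "Q \<in> strongly_convex_problems N d D (1 / r\<^sup>2) (1 / r\<^sup>2) r b \<sigma>" for Q
        using that by (simp add: strongly_convex_problems_def)
      define c where "c = r\<^sup>2 * (s i * t i)"
      have gap: "(x 0 - \<theta> * c)\<^sup>2 / (2 * r\<^sup>2) \<le> objective (?P s (\<lambda>j. \<theta> * t j)) i x -
          (INF y\<in>Rn d. objective (?P s (\<lambda>j. \<theta> * t j)) i y)" if "\<theta> = 1 \<or> \<theta> = - 1" for \<theta> x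
      proof -
        let ?y = "axis_vec d (r\<^sup>2 * (s i * (\<theta> * t i)))"
        have "(x 0 - \<theta> * c)\<^sup>2 = (x 0 - ?y 0)\<^sup>2" using d by (simp add: c_def algebra_simps)
        also have "\<dots> \<le> (dist_Rn d x ?y)\<^sup>2"
          unfolding dist_Rn_sq using d by (intro member_le_sum[of 0 "{..<d}" "\<lambda>c. (x c - ?y c)\<^sup>2"]) auto
        finally have "(x 0 - \<theta> * c)\<^sup>2 / (2 * r\<^sup>2) \<le> (dist_Rn d x ?y)\<^sup>2 / (2 * r\<^sup>2)"
          by (intro divide_right_mono) auto
        also have "\<dots> = objective (?P s (\<lambda>j. \<theta> * t j)) i x - (INF y\<in>Rn d. objective (?P s (\<lambda>j. \<theta> * t j)) i y)"
          by (rule quadratic_coin_problem(2)[where N = N and b = b and \<sigma> = \<sigma>, OF d D r that s t drift noise b i, symmetric])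
        finally show ?thesis .
      qed
      have "c = r * sqrt (4 * \<epsilon>)" using r by (simp add: c_def st \<phi>(1) power2_eq_square)
      then have c2: "c\<^sup>2 / r\<^sup>2 = 4 * \<epsilon>" using r \<epsilon> by (simp add: power_mult_distrib)
      show "4 * \<epsilon> \<le> objective (?P s (\<lambda>j. 1 * t j)) i x - (INF y\<in>Rn d. objective (?P s (\<lambda>j. 1 * t j)) i y) +
          (objective (?P s (\<lambda>j. - 1 * t j)) i x - (INF y\<in>Rn d. objective (?P s (\<lambda>j. - 1 * t j)) i y))" for x
      proof -
        have "c\<^sup>2 / r\<^sup>2 \<le> (x 0)\<^sup>2 / r\<^sup>2 + c\<^sup>2 / r\<^sup>2" by simp
        also have "\<dots> = (x 0 - 1 * c)\<^sup>2 / (2 * r\<^sup>2) + (x 0 - - 1 * c)\<^sup>2 / (2 * r\<^sup>2)"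
        proof -
          have "(x 0 - 1 * c)\<^sup>2 + (x 0 - - 1 * c)\<^sup>2 = 2 * ((x 0)\<^sup>2 + c\<^sup>2)"
            by (simp add: power2_eq_square algebra_simps)
          then show ?thesis
            unfolding add_divide_distrib[symmetric] by (simp only: mult_divide_mult_cancel_left_if) simp
        qed
        finally show ?thesis
          using gap[of 1 x] gap[of "- 1" x] unfolding c2 by linarith
      qed
      show "real N / (32 * m\<^sup>2 * real n) / real N * (\<Sum>j\<in>{1..N}. (t j)\<^sup>2) \<le> 1 / 16"
        unfolding t_def using budget_of_weights[OF \<phi>(5), of m] True m N by simp
    qed
    moreover have "ereal ?bound \<le> ereal (real N / (32 * m\<^sup>2 * real n))" using bound by simp
    ultimately show ?thesis by (rule order_trans[rotated])
  next
    case False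
    have "?P (\<lambda>_. 0) (\<lambda>j. 1 * 0) \<in> strongly_convex_problems N d D (1 / r\<^sup>2) (1 / r\<^sup>2) r b \<sigma>"
      by (rule quadratic_coin_problem(1)[OF d D r]) (use r nonneg in auto)
    from samples_used_1_le_complexity[OF N this]
    have "ereal (real (samples_used orc N 1)) \<le> ?complexity" .
    moreover have "num_close N \<epsilon> (\<lambda>i j. b i j / 4) i = 0" using False by (simp add: n_def)
    then have "ereal ?bound \<le> ereal (real (samples_used orc N 1))" by simp
    ultimately show ?thesis by (rule order_trans[rotated])
  qed
qed

theorem theorem1:
  shows "\<exists>C>0. \<exists>C'>0. \<forall>(orc::oracle_kind) (N::nat) (d::nat) (D::nat) (\<epsilon>::real) (r::real) (B::real)
      (\<sigma>::real) (b::nat \<Rightarrow> nat \<Rightarrow> real).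
    N \<ge> 1 \<longrightarrow> d \<ge> 1 \<longrightarrow> D \<ge> 1 \<longrightarrow> 0 < \<epsilon> \<longrightarrow> \<epsilon> < 1 / 16 \<longrightarrow> r > 0 \<longrightarrow> B > 0 \<longrightarrow> \<sigma> > 0 \<longrightarrow>
    (\<forall>i\<in>{1..N}. \<forall>j\<in>{1..N}. b i j \<ge> 0) \<longrightarrow>
    (\<forall>i\<in>{1..N}. \<forall>j\<in>{1..N}. b i j = b j i) \<longrightarrow>
    (\<forall>i\<in>{1..N}. \<forall>j\<in>{1..N}. \<forall>k\<in>{1..N}. b i j \<le> b i k + b k j) \<longrightarrow>
    (\<forall>i\<in>{1..N}.
      ((orc = Asynchronous \<longrightarrow> \<epsilon> < r * B / 16) \<longrightarrow>
        (INF M\<in>learning_methods orc N d D. SUP P\<in>convex_problems N d D r b B.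
            sample_complexity orc N d D \<epsilon> M P i)
          \<ge> ereal (C * r\<^sup>2 * B\<^sup>2 * real N / (\<epsilon>\<^sup>2 * real (num_close N \<epsilon> (\<lambda>i j. b i j / 4) i)))) \<and>
      (INF M\<in>learning_methods orc N d D.
          SUP P\<in>strongly_convex_problems N d D (1 / r\<^sup>2) (1 / r\<^sup>2) r b \<sigma>.
            sample_complexity orc N d D \<epsilon> M P i)
        \<ge> ereal (C' * r\<^sup>2 * \<sigma>\<^sup>2 * real N / (\<epsilon> * real (num_close N \<epsilon> (\<lambda>i j. b i j / 4) i))))"
proof (rule exI[of _ "1 / 2048"], rule conjI, simp, rule exI[of _ "1 / 128"], rule conjI, simp,
    intro allI impI ballI conjI)
  fix orc :: oracle_kind and N d D :: nat and \<epsilon> r B \<sigma> :: real and b :: "nat \<Rightarrow> nat \<Rightarrow> real" and i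
  assume a: "N \<ge> 1" "d \<ge> 1" "D \<ge> 1" "0 < \<epsilon>" "\<epsilon> < 1 / 16" "r > 0" "B > 0" "\<sigma> > 0"
    and nonneg: "\<forall>i\<in>{1..N}. \<forall>j\<in>{1..N}. b i j \<ge> 0"
    and sym: "\<forall>i\<in>{1..N}. \<forall>j\<in>{1..N}. b i j = b j i"
    and tri: "\<forall>i\<in>{1..N}. \<forall>j\<in>{1..N}. \<forall>k\<in>{1..N}. b i j \<le> b i k + b k j"
    and i: "i \<in> {1..N}"
  have nonneg': "0 \<le> b j k" and sym': "b j k = b k j" if "j \<in> {1..N}" "k \<in> {1..N}" for j k
    using nonneg sym that by blast+
  have tri': "b j k \<le> b j l + b l k" if "j \<in> {1..N}" "k \<in> {1..N}" "l \<in> {1..N}" for j k l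
    using tri that by blast
  show "ereal (1 / 2048 * r\<^sup>2 * B\<^sup>2 * real N / (\<epsilon>\<^sup>2 * real (num_close N \<epsilon> (\<lambda>i j. b i j / 4) i)))
      \<le> (INF M\<in>learning_methods orc N d D. SUP P\<in>convex_problems N d D r b B. sample_complexity orc N d D \<epsilon> M P i)"
    if small: "orc = Asynchronous \<longrightarrow> \<epsilon> < r * B / 16"
  proof (rule convex_lower_bound[where b = b, OF a(1-4,6,7) i nonneg' sym' tri'])
    assume "orc = Asynchronous"
    with small have "\<epsilon> < r * B / 16" by simp
    moreover have "0 < r * B" using a by simp
    ultimately show "\<epsilon> \<le> r * B / 8" by linarith
  qed
  have "\<epsilon> \<le> 1 / 4" using a(5) by simp
  then show "ereal (1 / 128 * r\<^sup>2 * \<sigma>\<^sup>2 * real N / (\<epsilon> * real (num_close N \<epsilon> (\<lambda>i j. b i j / 4) i)))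
      \<le> (INF M\<in>learning_methods orc N d D.
          SUP P\<in>strongly_convex_problems N d D (1 / r\<^sup>2) (1 / r\<^sup>2) r b \<sigma>. sample_complexity orc N d D \<epsilon> M P i)"
    by (rule strongly_convex_lower_bound[where b = b, OF a(1-4) _ a(6,8) i nonneg' sym' tri'])
qed

end
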